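(* The association scheme extension algorithm (described in the context) works correctly, and its running time is $d^{O(t)}$. That is: there is an absolute constant $c>0$ such that for every association scheme $\mathfrak{X}=(Q,\Gamma)$ on $Q=\{1,\dots,d\}$ and every $t\in\mathbb{N}$ with $1\le t\le d-2$, the algorithm on input $(\mathfrak{X},t)$ terminates after at most $d^{ct}$ elementary operations, and (i) if $\mathfrak{X}$ is extensible to height $t$, the algorithm outputs a $t$-extension $\{\Gamma^s\}_{1\le s\le t}$ of $\mathfrak{X}$; (ii) if $\mathfrak{X}$ is not extensible to height $t$, the algorithm outputs the decision that $\mathfrak{X}$ is not extensible to height $t$.
   Context: $\mathbb{N}$ includes $0$; all members of a partition are nonempty. Association scheme: for a finite nonempty set $Q$, a pair $\mathfrak{X}=(Q,\Gamma)$ where $\Gamma=\{C_1,\dots,C_s\}$ is a partition of $Q\times Q$ such that (A1) $C_1=\{(x,x)\mid x\in Q\}$; (A2) for every $C_i\in\Gamma$, $\{(y,x)\mid (x,y)\in C_i\}\in\Gamma$; (A3) for all $C_i,C_j,C_k\in\Gamma$ there is $c(i,j,k)\in\mathbb{N}$ with $|\{z\in Q\mid (x,z)\in C_i,\ (z,y)\in C_j\}|=c(i,j,k)$ for all $(x,y)\in C_k$. Notation: $\mathrm{pr}:Q^n\to Q^{n-1}$ deletes the last coordinate ($n>1$). For $\bar u=(u_1,\dots,u_n)\in Q^n$ and $\tau\in\mathrm{Symm}_n$ (symmetric group on $n$ elements), $\bar u^\tau:=(u_{\tau(1)},\dots,u_{\tau(n)})$, and $C^\tau:=\{\bar u^\tau\mid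 \bar u\in C\}$ for $C\subseteq Q^n$. $t$-prescheme (height $t$ presuperscheme) on $Q$, $t\in\mathbb{N}$: a family $\{\Gamma^n\}_{0\le n\le t}$, where $\Gamma^n=\{C^n_1,\dots,C^n_{s_n}\}$ is a partition of $Q^{n+2}$ into nonempty sets, such that (P1) $C^0_1=\{(x,x)\mid x\in Q\}$; (P2) for $1\le n\le t$ and $C\in\Gamma^n$, $\mathrm{pr}(C)\in\Gamma^{n-1}$; (P3) for $0\le n\le t$, $C\in\Gamma^n$, $\tau\in\mathrm{Symm}_{n+2}$, $C^\tau\in\Gamma^n$; (P4) for all $m,n\in\mathbb{N}$ with $m+n\le t$ and all $C^m_i\in\Gamma^m$, $C^n_j\in\Gamma^n$, $C^{m+n}_k\in\Gamma^{m+n}$ there is $c(i,j,k;m,n)\in\mathbb{N}$ such that for all $(x_0,\dots,x_m,y_0,\dots,y_n)\in C^{m+n}_k$, $|\{z\in Q\mid (x_0,\dots,x_m,z)\in C^m_i,\ (z,y_0,\dots,y_n)\in C^n_j\}|=c(i,j,k;m,n)$. An association scheme $\mathfrak{X}=(Q,\Gamma)$ is extensible to height $t$ if there is a $t$-prescheme $\{\Gamma^n\}_{0\le n\le t}$ on $Q$ with $\Gamma^0=\Gamma$; then $\{\Gamma^n\}_{1\le n\le t}$ is called a $t$-extension of $\mathfrak{X}$. Tensors: for $C\subseteq Q^n$ ($n\ge2$), the adjacency tensor $A(C):Q^n\to\mathbb{Z}$ is the indicator function of $C$. For $E:Q^m\to\mathbb{Z}$, $F:Q^n\to\mathbb{Z}$,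 the inner product $EF:Q^{m+n-2}\to\mathbb{Z}$ is $(EF)_{i_1\cdots i_{m+n-2}}=\sum_{j=1}^d E_{i_1\cdots i_{m-1}j}F_{j\,i_m\cdots i_{m+n-2}}$. The association scheme extension algorithm. Input: an association scheme $\mathfrak{X}=(Q,\Gamma)$ on $Q=\{1,\dots,d\}$ and $t\in\mathbb{N}$ with $1\le t\le d-2$. Throughout, $\Gamma^0:=\Gamma$ (never modified), and whenever a set is replaced by several sets, empty ones are discarded. Initialization: for $1\le s\le t$ set $\Gamma^s:=\{Q^{s+2}\}$. Step 1: for each $1\le s\le t$ and each $C\in\Gamma^s$, determine whether $\mathrm{pr}(C)$ is a union $C^{s-1}_{i_1}\cup\dots\cup C^{s-1}_{i_k}$ of members of $\Gamma^{s-1}$. If yes, replace $C$ in $\Gamma^s$ by the sets $C\cap\mathrm{pr}^{-1}(C^{s-1}_{i_1}),\dots,C\cap\mathrm{pr}^{-1}(C^{s-1}_{i_k})$. If no and $s>1$, replace in $\Gamma^{s-1}$ each $C'$ with $C'\cap\mathrm{pr}(C)\ne\emptyset$ by $C'\cap\mathrm{pr}(C)$ and $C'\setminus\mathrm{pr}(C)$. If no and $s=1$, terminate and output "$\mathfrak{X}$ is not extensible to height $t$". Step 2: for each $1\le s\le t$, each $C\in\Gamma^s$ and each $\tau\in\mathrm{Symm}_{s+2}$, replace in $\Gamma^s$ each $C'$ with $C'\cap C^\tau\ne\emptyset$ by $C'\cap C^\tau$ and $C'\setminus C^\tau$. Step 3: for each $1\le s\le t$, all $m,n\in\mathbb{N}$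 with $m+n=s$, and all $C^m_i\in\Gamma^m$, $C^n_j\in\Gamma^n$, compute $P:=A(C^m_i)A(C^n_j)$; for each $r=0,\dots,d$ let $P^{-1}(r)$ be the set of tuples in $Q^{s+2}$ at which $P$ has entry $r$, and replace in $\Gamma^s$ each $C$ with $C\cap P^{-1}(r)\ne\emptyset$ by $C\cap P^{-1}(r)$ and $C\setminus P^{-1}(r)$. Repeat Steps 1-3. If none of them yields any further refinement of the partitions $\Gamma^s$ ($1\le s\le t$), terminate and output $\{\Gamma^s\}_{1\le s\le t}$. *)

theory Defs
  imports
    Complex_Main
    "HOL-Library.Disjoint_Sets"
    "HOL-Library.Monad_Syntax"
    "HOL-Combinatorics.Permutations"
begin

section \<open>Association schemes, preschemes and extensions\<close>

definition association_scheme :: "'a set \<Rightarrow> ('a \<times> 'a) set set \<Rightarrow> bool" where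
  "association_scheme Q \<Gamma> \<longleftrightarrow>
     finite Q \<and> Q \<noteq> {} \<and> partition_on (Q \<times> Q) \<Gamma> \<and>
     {(x, x) | x. x \<in> Q} \<in> \<Gamma> \<and>
     (\<forall>C\<in>\<Gamma>. {(y, x) | x y. (x, y) \<in> C} \<in> \<Gamma>) \<and>
     (\<forall>A\<in>\<Gamma>. \<forall>B\<in>\<Gamma>. \<forall>C\<in>\<Gamma>. \<exists>c::nat. \<forall>(x, y)\<in>C.
        card {z \<in> Q. (x, z) \<in> A \<and> (z, y) \<in> B} = c)"

text \<open>Elements of \<open>Q\<^sup>n\<close> are lists of length \<open>n\<close>; coordinates are numbered from 0.  Thus the
  projection deleting the last coordinate is \<^const>\<open>butlast\<close>, the symmetric group on \<open>n\<close> elements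
  consists of the \<open>\<tau>\<close> with \<open>\<tau> permutes {..<n}\<close>, and the rearranged tuple whose \<open>i\<close>-th entry is the
  \<open>\<tau>(i)\<close>-th entry of \<open>u\<close> is \<open>permute_list \<tau> u\<close>.\<close>

definition tuples :: "'a set \<Rightarrow> nat \<Rightarrow> 'a list set" where
  "tuples Q n = {u. length u = n \<and> set u \<subseteq> Q}"

definition prescheme :: "'a set \<Rightarrow> nat \<Rightarrow> (nat \<Rightarrow> 'a list set set) \<Rightarrow> bool" where
  "prescheme Q t \<Gamma> \<longleftrightarrow>
     (\<forall>n\<le>t. partition_on (tuples Q (n + 2)) (\<Gamma> n)) \<and>
     {[x, x] | x. x \<in> Q} \<in> \<Gamma> 0 \<and>
     (\<forall>n. 1 \<le> n \<and> n \<le> t \<longrightarrow> (\<forall>C\<in>\<Gamma> n. butlast ` C \<in> \<Gamma> (n - 1))) \<and>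
     (\<forall>n\<le>t. \<forall>C\<in>\<Gamma> n. \<forall>\<tau>. \<tau> permutes {..<n + 2} \<longrightarrow> permute_list \<tau> ` C \<in> \<Gamma> n) \<and>
     (\<forall>m n. m + n \<le> t \<longrightarrow>
        (\<forall>A\<in>\<Gamma> m. \<forall>B\<in>\<Gamma> n. \<forall>C\<in>\<Gamma> (m + n). \<exists>c::nat.
           \<forall>x y. length x = m + 1 \<and> length y = n + 1 \<and> x @ y \<in> C \<longrightarrow>
             card {z \<in> Q. x @ [z] \<in> A \<and> z # y \<in> B} = c))"

text \<open>A relation on \<open>Q\<close> read as a set of tuples of length 2.\<close>

definition pair_tuples :: "('a \<times> 'a) set set \<Rightarrow> 'a list set set" where
  "pair_tuples \<Gamma> = (\<lambda>C. {[x, y] | x y. (x, y) \<in> C}) ` \<Gamma>"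

definition extensible :: "'a set \<Rightarrow> ('a \<times> 'a) set set \<Rightarrow> nat \<Rightarrow> bool" where
  "extensible Q \<Gamma> t \<longleftrightarrow> (\<exists>\<Gamma>'. prescheme Q t \<Gamma>' \<and> \<Gamma>' 0 = pair_tuples \<Gamma>)"

text \<open>Only the values of \<open>\<Gamma>'\<close> at \<open>1, \<dots>, t\<close> matter here.\<close>

definition t_extension ::
  "'a set \<Rightarrow> ('a \<times> 'a) set set \<Rightarrow> nat \<Rightarrow> (nat \<Rightarrow> 'a list set set) \<Rightarrow> bool" where
  "t_extension Q \<Gamma> t \<Gamma>' \<longleftrightarrow> prescheme Q t (\<Gamma>'(0 := pair_tuples \<Gamma>))"


section \<open>Computations with a count of elementary operations\<close>

text \<open>Cost model: programs are written over lists and natural or integer numbers, and one unit is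
  charged for every call of a recursive function, i.e. at every \<open>tick\<close> (as in the library theory
  \<open>Time_Commands\<close>).  Between two ticks a program only performs a bounded number of list
  constructor applications, case distinctions on the outermost constructor, and arithmetic
  operations or comparisons on single numbers of absolute value at most \<open>d + 2\<close>, where \<open>d\<close> is the
  number of points.  In particular, lists are never compared, searched, indexed or concatenated at
  unit cost.\<close>

datatype 'a timed = Timed (result: 'a) (time: nat)

definition return :: "'a \<Rightarrow> 'a timed" where
  "return x = Timed x 0"

definition bind_timed :: "'a timed \<Rightarrow> ('a \<Rightarrow> 'b timed) \<Rightarrow> 'b timed" where
  "bind_timed c f = Timed (result (f (result c))) (time c + time (f (result c)))"

definition tick :: "'a timed \<Rightarrow> 'a timed" where
  "tick c = Timed (result c) (time c + 1)"

adhoc_overloading Monad_Syntax.bind \<rightleftharpoons> bind_timed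

subsection \<open>Lists\<close>

primrec map_t :: "('a \<Rightarrow> 'b timed) \<Rightarrow> 'a list \<Rightarrow> 'b list timed" where
  "map_t f [] = tick (return [])"
| "map_t f (x # xs) = tick (do { y \<leftarrow> f x; ys \<leftarrow> map_t f xs; return (y # ys) })"

primrec filter_t :: "('a \<Rightarrow> bool timed) \<Rightarrow> 'a list \<Rightarrow> 'a list timed" where
  "filter_t p [] = tick (return [])"
| "filter_t p (x # xs) =
     tick (do { b \<leftarrow> p x; ys \<leftarrow> filter_t p xs; return (if b then x # ys else ys) })"

primrec any_t :: "('a \<Rightarrow> bool timed) \<Rightarrow> 'a list \<Rightarrow> bool timed" where
  "any_t p [] = tick (return False)"
| "any_t p (x # xs) = tick (do { b \<leftarrow> p x; if b then return True else any_t p xs })"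

primrec all_t :: "('a \<Rightarrow> bool timed) \<Rightarrow> 'a list \<Rightarrow> bool timed" where
  "all_t p [] = tick (return True)"
| "all_t p (x # xs) = tick (do { b \<leftarrow> p x; if b then all_t p xs else return False })"

primrec fold_t :: "('a \<Rightarrow> 's \<Rightarrow> 's timed) \<Rightarrow> 'a list \<Rightarrow> 's \<Rightarrow> 's timed" where
  "fold_t f [] s = tick (return s)"
| "fold_t f (x # xs) s = tick (do { s' \<leftarrow> f x s; fold_t f xs s' })"

text \<open>As \<^const>\<open>fold_t\<close>, but stopping immediately at the first \<^const>\<open>None\<close>.\<close>

primrec fold_option_t ::
  "('a \<Rightarrow> 's \<Rightarrow> 's option timed) \<Rightarrow> 'a list \<Rightarrow> 's \<Rightarrow> 's option timed" where
  "fold_option_t f [] s = tick (return (Some s))"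
| "fold_option_t f (x # xs) s = tick (do {
     r \<leftarrow> f x s;
     case r of None \<Rightarrow> return None | Some s' \<Rightarrow> fold_option_t f xs s' })"

primrec append_t :: "'a list \<Rightarrow> 'a list \<Rightarrow> 'a list timed" where
  "append_t [] ys = tick (return ys)"
| "append_t (x # xs) ys = tick (do { zs \<leftarrow> append_t xs ys; return (x # zs) })"

primrec concat_t :: "'a list list \<Rightarrow> 'a list timed" where
  "concat_t [] = tick (return [])"
| "concat_t (xs # xss) = tick (do { ys \<leftarrow> concat_t xss; append_t xs ys })"

fun nth_t :: "'a list \<Rightarrow> nat \<Rightarrow> 'a timed" where
  "nth_t [] n = tick (return undefined)"
| "nth_t (x # xs) 0 = tick (return x)"
| "nth_t (x # xs) (Suc n) = tick (nth_t xs n)"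

fun update_t :: "'a list \<Rightarrow> nat \<Rightarrow> 'a \<Rightarrow> 'a list timed" where
  "update_t [] n y = tick (return [])"
| "update_t (x # xs) 0 y = tick (return (y # xs))"
| "update_t (x # xs) (Suc n) y = tick (do { ys \<leftarrow> update_t xs n y; return (x # ys) })"

fun take_t :: "nat \<Rightarrow> 'a list \<Rightarrow> 'a list timed" where
  "take_t 0 xs = tick (return [])"
| "take_t (Suc n) [] = tick (return [])"
| "take_t (Suc n) (x # xs) = tick (do { ys \<leftarrow> take_t n xs; return (x # ys) })"

fun drop_t :: "nat \<Rightarrow> 'a list \<Rightarrow> 'a list timed" where
  "drop_t 0 xs = tick (return xs)"
| "drop_t (Suc n) [] = tick (return [])"
| "drop_t (Suc n) (x # xs) = tick (drop_t n xs)"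

fun butlast_t :: "'a list \<Rightarrow> 'a list timed" where
  "butlast_t [] = tick (return [])"
| "butlast_t [x] = tick (return [])"
| "butlast_t (x # y # zs) = tick (do { us \<leftarrow> butlast_t (y # zs); return (x # us) })"

fun all2_t :: "('a \<Rightarrow> 'b \<Rightarrow> bool timed) \<Rightarrow> 'a list \<Rightarrow> 'b list \<Rightarrow> bool timed" where
  "all2_t p [] [] = tick (return True)"
| "all2_t p (x # xs) (y # ys) =
     tick (do { b \<leftarrow> p x y; if b then all2_t p xs ys else return False })"
| "all2_t p _ _ = tick (return False)"

text \<open>\<open>count_from k i\<close> returns \<open>[i, i + 1, \<dots>, i + k - 1]\<close>.\<close>

primrec count_from :: "nat \<Rightarrow> nat \<Rightarrow> nat list timed" where
  "count_from 0 i = tick (return [])"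
| "count_from (Suc k) i = tick (do { is \<leftarrow> count_from k (Suc i); return (i # is) })"

primrec insertions_t :: "'a \<Rightarrow> 'a list \<Rightarrow> 'a list list timed" where
  "insertions_t x [] = tick (return [[x]])"
| "insertions_t x (y # ys) = tick (do {
     zss \<leftarrow> insertions_t x ys;
     zss' \<leftarrow> map_t (\<lambda>zs. return (y # zs)) zss;
     return ((x # y # ys) # zss') })"

primrec permutations_t :: "'a list \<Rightarrow> 'a list list timed" where
  "permutations_t [] = tick (return [[]])"
| "permutations_t (x # xs) = tick (do {
     ps \<leftarrow> permutations_t xs;
     qss \<leftarrow> map_t (insertions_t x) ps;
     concat_t qss })"

primrec tuples_t :: "'a list \<Rightarrow> nat \<Rightarrow> 'a list list timed" where
  "tuples_t qs 0 = tick (return [[]])"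
| "tuples_t qs (Suc n) = tick (do {
     us \<leftarrow> tuples_t qs n;
     vss \<leftarrow> map_t (\<lambda>q. map_t (\<lambda>u. return (q # u)) us) qs;
     concat_t vss })"

subsection \<open>Sets of tuples as lists\<close>

type_synonym tuple = "nat list"
type_synonym cell = "tuple list"
type_synonym cells = "cell list"

text \<open>A list of lists represents a set of sets without repetitions, in any order.\<close>

definition encodes :: "'a list list \<Rightarrow> 'a set set \<Rightarrow> bool" where
  "encodes P \<Gamma> \<longleftrightarrow> set ` set P = \<Gamma> \<and> distinct (map set P) \<and> (\<forall>C\<in>set P. distinct C)"

definition eq_tuple_t :: "tuple \<Rightarrow> tuple \<Rightarrow> bool timed" where
  "eq_tuple_t u v = all2_t (\<lambda>x y. return (x = y)) u v"

definition member_t :: "tuple \<Rightarrow> cell \<Rightarrow> bool timed" where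
  "member_t u C = any_t (eq_tuple_t u) C"

definition subset_t :: "cell \<Rightarrow> cell \<Rightarrow> bool timed" where
  "subset_t C D = all_t (\<lambda>u. member_t u D) C"

definition set_eq_t :: "cell \<Rightarrow> cell \<Rightarrow> bool timed" where
  "set_eq_t C D = do { b \<leftarrow> subset_t C D; if b then subset_t D C else return False }"

definition inter_t :: "cell \<Rightarrow> cell \<Rightarrow> cell timed" where
  "inter_t C S = filter_t (\<lambda>u. member_t u S) C"

definition diff_t :: "cell \<Rightarrow> cell \<Rightarrow> cell timed" where
  "diff_t C S = filter_t (\<lambda>u. do { b \<leftarrow> member_t u S; return (\<not> b) }) C"

text \<open>Replace every cell \<open>C\<close> of \<open>P\<close> meeting \<open>S\<close> by the nonempty ones among \<open>C \<inter> S\<close> and \<open>C - S\<close>.\<close>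

definition split_t :: "cell \<Rightarrow> cell \<Rightarrow> cells timed" where
  "split_t S C = do {
     I \<leftarrow> inter_t C S;
     D \<leftarrow> diff_t C S;
     return (if I = [] then [C] else if D = [] then [I] else [I, D]) }"

definition refine_t :: "cell \<Rightarrow> cells \<Rightarrow> cells timed" where
  "refine_t S P = do { Pss \<leftarrow> map_t (split_t S) P; concat_t Pss }"

text \<open>Replace the cell \<open>C\<close> of \<open>P\<close> by the nonempty ones among \<open>Ds\<close>.\<close>

definition replace_t :: "cell \<Rightarrow> cells \<Rightarrow> cells \<Rightarrow> cells timed" where
  "replace_t C Ds P = do {
     Es \<leftarrow> filter_t (\<lambda>D. return (D \<noteq> [])) Ds;
     Pss \<leftarrow> map_t (\<lambda>C'. do { b \<leftarrow> set_eq_t C' C; return (if b then Es else [C']) }) P;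
     concat_t Pss }"


section \<open>The extension algorithm\<close>

text \<open>The current partitions are kept as a list whose \<open>s\<close>-th entry encodes \<open>\<Gamma>\<^sup>s\<close>, \<open>0 \<le> s \<le> t\<close>.
  A loop over the cells of a partition runs over the cells present when the loop is entered, in the
  order in which they are listed.\<close>

type_synonym state = "cells list"

definition refine_level_t :: "nat \<Rightarrow> cell \<Rightarrow> state \<Rightarrow> state timed" where
  "refine_level_t s S G = do { P \<leftarrow> nth_t G s; P' \<leftarrow> refine_t S P; update_t G s P' }"

subsection \<open>Step 1\<close>

definition pr_t :: "cell \<Rightarrow> cell timed" where
  "pr_t C = map_t butlast_t C"

definition inter_pr_vimage_t :: "cell \<Rightarrow> cell \<Rightarrow> cell timed" where
  "inter_pr_vimage_t C B = filter_t (\<lambda>u. do { v \<leftarrow> butlast_t u; member_t v B }) C"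

text \<open>\<open>Bs\<close> lists the members of \<open>\<Gamma>\<^sup>s\<^sup>-\<^sup>1\<close> contained in \<open>pr C\<close>; hence \<open>pr C\<close> is a union of members of
  \<open>\<Gamma>\<^sup>s\<^sup>-\<^sup>1\<close> iff it is covered by \<open>Bs\<close>, and then it is the union of \<open>Bs\<close>.  The result \<^const>\<open>None\<close>
  is the decision that the scheme is not extensible.\<close>

definition step1_cell :: "nat \<Rightarrow> cell \<Rightarrow> state \<Rightarrow> state option timed" where
  "step1_cell s C G = do {
     R \<leftarrow> pr_t C;
     below \<leftarrow> nth_t G (s - 1);
     Bs \<leftarrow> filter_t (\<lambda>B. subset_t B R) below;
     is_union \<leftarrow> all_t (\<lambda>u. any_t (member_t u) Bs) R;
     if is_union then do {
       Ds \<leftarrow> map_t (inter_pr_vimage_t C) Bs;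
       P \<leftarrow> nth_t G s;
       P' \<leftarrow> replace_t C Ds P;
       G' \<leftarrow> update_t G s P';
       return (Some G')
     }
     else if s > 1 then do {
       G' \<leftarrow> refine_level_t (s - 1) R G;
       return (Some G')
     }
     else return None }"

definition step1 :: "nat \<Rightarrow> state \<Rightarrow> state option timed" where
  "step1 t G = do {
     levels \<leftarrow> count_from t 1;
     fold_option_t (\<lambda>s G. do {
       P \<leftarrow> nth_t G s;
       fold_option_t (step1_cell s) P G }) levels G }"

subsection \<open>Step 2\<close>

text \<open>A permutation is given by the list of its values.\<close>

definition permute_t :: "nat list \<Rightarrow> tuple \<Rightarrow> tuple timed" where
  "permute_t \<tau> u = map_t (nth_t u) \<tau>"

definition step2 :: "nat \<Rightarrow> state \<Rightarrow> state timed" where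
  "step2 t G = do {
     levels \<leftarrow> count_from t 1;
     fold_t (\<lambda>s G. do {
       P \<leftarrow> nth_t G s;
       positions \<leftarrow> count_from (s + 2) 0;
       symm \<leftarrow> permutations_t positions;
       fold_t (\<lambda>C. fold_t (\<lambda>\<tau> G. do {
         S \<leftarrow> map_t (permute_t \<tau>) C;
         refine_level_t s S G }) symm) P G }) levels G }"

subsection \<open>Step 3\<close>

definition adjacency_t :: "cell \<Rightarrow> tuple \<Rightarrow> int timed" where
  "adjacency_t C u = do { b \<leftarrow> member_t u C; return (if b then 1 else 0) }"

text \<open>The entry at \<open>u\<close> of the inner product of two tensors, the first one with \<open>k + 1\<close> indices;
  the summation index runs through \<open>qs\<close>.\<close>

definition inner_product_entry_t ::
  "nat list \<Rightarrow> nat \<Rightarrow> (tuple \<Rightarrow> int timed) \<Rightarrow> (tuple \<Rightarrow> int timed) \<Rightarrow> tuple \<Rightarrow> int timed" where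
  "inner_product_entry_t qs k E F u = do {
     x \<leftarrow> take_t k u;
     y \<leftarrow> drop_t k u;
     fold_t (\<lambda>j a. do {
       xj \<leftarrow> append_t x [j];
       e \<leftarrow> E xj;
       f \<leftarrow> F (j # y);
       return (a + e * f) }) qs 0 }"

definition step3_pair :: "nat \<Rightarrow> nat \<Rightarrow> nat \<Rightarrow> cell \<Rightarrow> cell \<Rightarrow> state \<Rightarrow> state timed" where
  "step3_pair d s m A B G = do {
     qs \<leftarrow> count_from d 1;
     us \<leftarrow> tuples_t qs (s + 2);
     P \<leftarrow> map_t (\<lambda>u. do {
       p \<leftarrow> inner_product_entry_t qs (m + 1) (adjacency_t A) (adjacency_t B) u;
       return (u, p) }) us;
     rs \<leftarrow> count_from (d + 1) 0;
     fold_t (\<lambda>r G. do {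
       Pr \<leftarrow> filter_t (\<lambda>(u, p). return (p = int r)) P;
       S \<leftarrow> map_t (\<lambda>(u, p). return u) Pr;
       refine_level_t s S G }) rs G }"

definition step3 :: "nat \<Rightarrow> nat \<Rightarrow> state \<Rightarrow> state timed" where
  "step3 d t G = do {
     levels \<leftarrow> count_from t 1;
     fold_t (\<lambda>s G. do {
       ms \<leftarrow> count_from (s + 1) 0;
       fold_t (\<lambda>m G. do {
         As \<leftarrow> nth_t G m;
         Bs \<leftarrow> nth_t G (s - m);
         fold_t (\<lambda>A. fold_t (\<lambda>B. step3_pair d s m A B) Bs) As G }) ms G }) levels G }"

subsection \<open>Main loop\<close>

text \<open>Steps 1 to 3 only ever split cells, so a refinement has taken place iff the number of cells of
  some partition has changed.\<close>

definition same_length_t :: "'a list \<Rightarrow> 'b list \<Rightarrow> bool timed" where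
  "same_length_t xs ys = all2_t (\<lambda>x y. return True) xs ys"

definition pass :: "nat \<Rightarrow> nat \<Rightarrow> state \<Rightarrow> (state \<times> bool) option timed" where
  "pass d t G = do {
     r \<leftarrow> step1 t G;
     case r of
       None \<Rightarrow> return None
     | Some G1 \<Rightarrow> do {
         G2 \<leftarrow> step2 t G1;
         G3 \<leftarrow> step3 d t G2;
         same \<leftarrow> all2_t same_length_t G G3;
         return (Some (G3, \<not> same)) } }"

datatype outcome = Not_Extensible | Extension "cells list"

text \<open>The value \<^const>\<open>None\<close> means that the loop does not terminate.\<close>

partial_function (option) iterate :: "nat \<Rightarrow> nat \<Rightarrow> state \<Rightarrow> outcome timed option" where
  "iterate d t G =
     (case pass d t G of
        Timed None n \<Rightarrow> Some (Timed Not_Extensible (n + 1))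
      | Timed (Some (G', refined)) n \<Rightarrow>
          if refined
          then Option.bind (iterate d t G')
                 (\<lambda>r. Some (Timed (result r) (n + 1 + time r)))
          else Some (Timed (Extension (tl G')) (n + 1)))"

definition initial_state :: "nat \<Rightarrow> nat \<Rightarrow> cells \<Rightarrow> state timed" where
  "initial_state d t P0 = do {
     levels \<leftarrow> count_from t 1;
     qs \<leftarrow> count_from d 1;
     Ps \<leftarrow> map_t (\<lambda>s. do { us \<leftarrow> tuples_t qs (s + 2); return [us] }) levels;
     return (P0 # Ps) }"

text \<open>The whole algorithm, on the points \<open>1, \<dots>, d\<close>, for the height \<open>t\<close> and the association scheme
  whose relations are listed in \<open>P0\<close> as sets of tuples of length 2.  The partitions
  \<open>\<Gamma>\<^sup>1, \<dots>, \<Gamma>\<^sup>t\<close> are output in this order.\<close>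

definition extension_algorithm :: "nat \<Rightarrow> nat \<Rightarrow> cells \<Rightarrow> outcome timed option" where
  "extension_algorithm d t P0 =
     map_option (\<lambda>r. Timed (result r) (time (initial_state d t P0) + time r))
       (iterate d t (result (initial_state d t P0)))"

text \<open>The output is a t-extension, given as a list of \<open>t\<close> encoded partitions.\<close>

definition outputs_extension ::
  "nat \<Rightarrow> nat \<Rightarrow> (nat \<times> nat) set set \<Rightarrow> outcome \<Rightarrow> bool" where
  "outputs_extension d t \<Gamma> out \<longleftrightarrow>
     (\<exists>Ps \<Gamma>'. out = Extension Ps \<and> length Ps = t \<and>
        (\<forall>s. 1 \<le> s \<and> s \<le> t \<longrightarrow> encodes (Ps ! (s - 1)) (\<Gamma>' s)) \<and>
        t_extension {1..d} \<Gamma> t \<Gamma>')"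

end

theory Submission
  imports Defs
begin

text \<open>Both halves of correctness rest on the fact that the algorithm only ever splits cells.

Nothing is split without necessity.  Call a set of tuples of length \<open>s + 2\<close> forced if in every
prescheme extending the given scheme it is a union of cells of level \<open>s\<close>.  The full sets of tuples
are forced, and so is every set along which the algorithm cuts: projections and preimages of forced
sets under the projection, because projections of cells are cells; rearrangements, because
rearranged cells are cells; and the level sets of a product of two adjacency tensors
(\<open>forced_inner_entry\<close>), because an entry of the product of two unions of cells is a sum of
intersection numbers of cells.  Hence all cells stay forced throughout.  If an extension exists,
the projection of a forced set of triples is therefore a union of relations of the scheme, so that
the negative answer, which is given only when this fails, is right (\<open>step1_cell_None\<close>).

A pass without effect certifies an extension.  Each elementary update returns its input literally
unchanged or increases the number of cells; this is the relation \<open>grows\<close>.  A pass after which the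
numbers of cells are the old ones has therefore not changed the state at any moment, so that each
single update inside it was trivial.  That the updates of the three steps are trivial says,
respectively, that projections of cells are cells, that rearranged cells are cells, and that the
products of adjacency tensors are constant on cells; for level 0 the last two are part of the
definition of an association scheme.  So the output is a prescheme (\<open>fixed_point_extends\<close>).

For the running time put \<open>N = d ^ (t + 2)\<close>.  The cells of a level partition at most \<open>N\<close> tuples and
are never empty, and \<open>(t + 2)! \<le> N\<close> since \<open>t + 2 \<le> d\<close>; so all loops have at most \<open>N\<close> rounds, and a loop
whose body costs at most \<open>N ^ j\<close> costs at most \<open>N ^ (j + 2)\<close> (\<open>loop_cost\<close>).  As the nesting depth is
bounded, one pass costs at most \<open>N ^ 28\<close>.  Every pass but the last increases the number of cells,
which never exceeds \<open>N ^ 2\<close>.  Altogether the cost is at most \<open>N ^ 33\<close>, and \<open>33 * (t + 2) \<le> 99 * t\<close>.\<close>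

section \<open>Values and costs of the list programs\<close>

lemma result_return [simp]: "result (return x) = x"
  and time_return [simp]: "time (return x) = 0"
  by (simp_all add: return_def)

lemma result_bind [simp]: "result (bind_timed c f) = result (f (result c))"
  and time_bind [simp]: "time (bind_timed c f) = time c + time (f (result c))"
  by (simp_all add: bind_timed_def)

lemma result_tick [simp]: "result (tick c) = result c"
  and time_tick [simp]: "time (tick c) = Suc (time c)"
  by (simp_all add: tick_def)

lemma time_if: "time (if b then c else c') = (if b then time c else time c')"
  by simp

lemma bind_timed_assoc: "bind_timed (bind_timed c f) g = bind_timed c (\<lambda>x. bind_timed (f x) g)"
  by (simp add: bind_timed_def)

subsection \<open>Values\<close>

lemma result_map_t [simp]: "result (map_t f xs) = map (\<lambda>x. result (f x)) xs"
  by (induction xs) simp_all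

lemma result_filter_t [simp]: "result (filter_t p xs) = filter (\<lambda>x. result (p x)) xs"
  by (induction xs) simp_all

lemma result_any_t [simp]: "result (any_t p xs) \<longleftrightarrow> (\<exists>x\<in>set xs. result (p x))"
  by (induction xs) simp_all

lemma result_all_t [simp]: "result (all_t p xs) \<longleftrightarrow> (\<forall>x\<in>set xs. result (p x))"
  by (induction xs) simp_all

lemma result_fold_t [simp]: "result (fold_t f xs s) = fold (\<lambda>x s. result (f x s)) xs s"
  by (induction xs arbitrary: s) simp_all

lemma result_append_t [simp]: "result (append_t xs ys) = xs @ ys"
  by (induction xs) simp_all

lemma result_concat_t [simp]: "result (concat_t xss) = concat xss"
  by (induction xss) simp_all

lemma result_nth_t [simp]: "n < length xs \<Longrightarrow> result (nth_t xs n) = xs ! n"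
  by (induction xs n rule: nth_t.induct) simp_all

lemma result_update_t [simp]: "result (update_t xs n y) = xs[n := y]"
  by (induction xs n y rule: update_t.induct) simp_all

lemma result_take_t [simp]: "result (take_t n xs) = take n xs"
  by (induction n xs rule: take_t.induct) simp_all

lemma result_drop_t [simp]: "result (drop_t n xs) = drop n xs"
  by (induction n xs rule: drop_t.induct) simp_all

lemma result_butlast_t [simp]: "result (butlast_t xs) = butlast xs"
  by (induction xs rule: butlast_t.induct) simp_all

lemma result_all2_t [simp]: "result (all2_t p xs ys) = list_all2 (\<lambda>x y. result (p x y)) xs ys"
  by (induction p xs ys rule: all2_t.induct) simp_all

lemma result_count_from [simp]: "result (count_from k i) = [i..<i + k]"
  by (induction k arbitrary: i) (simp_all add: upt_conv_Cons)

lemma length_result_insertions_t [simp]: "length (result (insertions_t x ys)) = Suc (length ys)"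
  by (induction ys) simp_all

lemma ex_list_cases: "(\<exists>xs. P xs) \<longleftrightarrow> P [] \<or> (\<exists>x xs. P (x # xs))"
  by (metis list.exhaust)

lemma set_result_insertions_t:
  "set (result (insertions_t x ys)) = {as @ x # bs | as bs. ys = as @ bs}"
proof (induction ys)
  case (Cons y ys)
  have "zs \<in> set (result (insertions_t x (y # ys))) \<longleftrightarrow> (\<exists>as bs. zs = as @ x # bs \<and> y # ys = as @ bs)"
    for zs
  proof -
    have "zs \<in> set (result (insertions_t x (y # ys))) \<longleftrightarrow>
        zs = x # y # ys \<or> (\<exists>as bs. zs = y # as @ x # bs \<and> ys = as @ bs)"
      using Cons.IH by auto
    also have "\<dots> \<longleftrightarrow> (\<exists>as bs. zs = as @ x # bs \<and> y # ys = as @ bs)"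
      by (subst (2) ex_list_cases) auto
    finally show ?thesis .
  qed
  then show ?case
    by blast
qed simp

lemma set_result_permutations_t:
  "set (result (permutations_t xs)) = {ys. mset ys = mset xs}"
proof (induction xs)
  case (Cons x xs)
  have "(\<exists>zs. mset zs = mset xs \<and> ys \<in> {as @ x # bs | as bs. zs = as @ bs}) \<longleftrightarrow>
    mset ys = mset (x # xs)" for ys
  proof
    assume "mset ys = mset (x # xs)"
    moreover from this have "x \<in> set ys" by (metis list.set_intros(1) set_mset_mset)
    then obtain as bs where "ys = as @ x # bs" by (meson split_list)
    ultimately show "\<exists>zs. mset zs = mset xs \<and> ys \<in> {as @ x # bs | as bs. zs = as @ bs}"
      by (intro exI[of _ "as @ bs"]) auto
  qed auto
  then show ?case
    using Cons.IH by (auto simp: set_result_insertions_t)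
qed simp

lemma length_concat_map_const:
  "(\<And>x. x \<in> set xs \<Longrightarrow> length (f x) = k) \<Longrightarrow> length (concat (map f xs)) = length xs * k"
  by (induction xs) simp_all

lemma length_result_permutations_t: "length (result (permutations_t xs)) = fact (length xs)"
proof (induction xs)
  case (Cons x xs)
  have "length ys = length xs" if "ys \<in> set (result (permutations_t xs))" for ys
    using that by (auto simp: set_result_permutations_t dest: mset_eq_length)
  then have "length (concat (map (\<lambda>ys. result (insertions_t x ys)) (result (permutations_t xs))))
      = length (result (permutations_t xs)) * Suc (length xs)"
    by (intro length_concat_map_const) simp
  then show ?case
    using Cons.IH by simp
qed simp

lemma set_result_tuples_t: "set (result (tuples_t qs n)) = tuples (set qs) n"
proof (induction n)
  case (Suc n)
  have "v \<in> (\<Union>q\<in>set qs. (#) q ` tuples (set qs) n) \<longleftrightarrow> v \<in> tuples (set qs) (Suc n)" for v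
    by (cases v) (auto simp: tuples_def)
  then show ?case
    using Suc.IH by auto
qed (auto simp: tuples_def)

lemma distinct_result_tuples_t: "distinct qs \<Longrightarrow> distinct (result (tuples_t qs n))"
proof (induction n)
  case (Suc n)
  then have IH: "distinct (result (tuples_t qs n))"
    by simp
  have "distinct (concat (map (\<lambda>q. map ((#) q) us) ps))"
    if "distinct ps" "distinct us" for ps :: "'a list" and us
    using that by (induction ps) (auto simp: distinct_map)
  with IH Suc.prems show ?case
    by simp
qed simp

lemma length_result_tuples_t: "length (result (tuples_t qs n)) = length qs ^ n"
proof (induction n)
  case (Suc n)
  then show ?case
    by (simp add: length_concat_map_const[where k = "length qs ^ n"])
qed simp

lemma result_permute_t:
  "set \<tau> \<subseteq> {..<length u} \<Longrightarrow> result (permute_t \<tau> u) = map ((!) u) \<tau>"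
  by (auto simp: permute_t_def)

subsection \<open>Costs\<close>

lemma time_map_t:
  "(\<And>x. x \<in> set xs \<Longrightarrow> time (f x) \<le> k) \<Longrightarrow> time (map_t f xs) \<le> length xs * (k + 1) + 1"
proof (induction xs)
  case (Cons x xs)
  then have "time (f x) \<le> k" "time (map_t f xs) \<le> length xs * (k + 1) + 1"
    by simp_all
  then show ?case by (simp add: time_if)
qed simp

lemma time_filter_t:
  "(\<And>x. x \<in> set xs \<Longrightarrow> time (p x) \<le> k) \<Longrightarrow> time (filter_t p xs) \<le> length xs * (k + 1) + 1"
proof (induction xs)
  case (Cons x xs)
  then have "time (p x) \<le> k" "time (filter_t p xs) \<le> length xs * (k + 1) + 1"
    by simp_all
  then show ?case by (simp add: time_if)
qed simp

lemma time_any_t: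
  "(\<And>x. x \<in> set xs \<Longrightarrow> time (p x) \<le> k) \<Longrightarrow> time (any_t p xs) \<le> length xs * (k + 1) + 1"
proof (induction xs)
  case (Cons x xs)
  then have "time (p x) \<le> k" "time (any_t p xs) \<le> length xs * (k + 1) + 1"
    by simp_all
  then show ?case by (simp add: time_if)
qed simp

lemma time_all_t:
  "(\<And>x. x \<in> set xs \<Longrightarrow> time (p x) \<le> k) \<Longrightarrow> time (all_t p xs) \<le> length xs * (k + 1) + 1"
proof (induction xs)
  case (Cons x xs)
  then have "time (p x) \<le> k" "time (all_t p xs) \<le> length xs * (k + 1) + 1"
    by simp_all
  then show ?case by (simp add: time_if)
qed simp

lemma time_all2_t:
  "(\<And>x y. x \<in> set xs \<Longrightarrow> time (p x y) \<le> k) \<Longrightarrow> time (all2_t p xs ys) \<le> length xs * (k + 1) + 1"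
proof (induction p xs ys rule: all2_t.induct)
  case (2 p x xs y ys)
  have "time (p x y) \<le> k" "result (p x y) \<Longrightarrow> time (all2_t p xs ys) \<le> length xs * (k + 1) + 1"
    using 2 by simp_all
  then show ?case by (cases "result (p x y)") simp_all
qed simp_all

lemma time_fold_t:
  assumes "\<And>x s. x \<in> set xs \<Longrightarrow> I s \<Longrightarrow> time (f x s) \<le> k \<and> I (result (f x s))" and "I s"
  shows "time (fold_t f xs s) \<le> length xs * (k + 1) + 1"
  using assms
proof (induction xs arbitrary: s)
  case (Cons x xs)
  have "time (f x s) \<le> k" "I (result (f x s))"
    using Cons.prems by simp_all
  moreover from this have "time (fold_t f xs (result (f x s))) \<le> length xs * (k + 1) + 1"
    using Cons.prems by (intro Cons.IH) simp_all
  ultimately show ?case by simp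
qed simp

lemma time_append_t: "time (append_t xs ys) \<le> length xs + 1"
  by (induction xs) simp_all

lemma time_concat_t:
  "(\<And>xs. xs \<in> set xss \<Longrightarrow> length xs \<le> k) \<Longrightarrow> time (concat_t xss) \<le> length xss * (k + 2) + 1"
proof (induction xss)
  case (Cons xs xss)
  have "time (append_t xs (concat xss)) \<le> k + 1"
    using time_append_t[of xs "concat xss"] Cons.prems[of xs] by simp
  with Cons show ?case by simp
qed simp

lemma time_nth_t: "time (nth_t xs n) \<le> length xs + 1"
  by (induction xs n rule: nth_t.induct) simp_all

lemma time_update_t: "time (update_t xs n y) \<le> length xs + 1"
  by (induction xs n y rule: update_t.induct) simp_all

lemma time_take_t: "time (take_t n xs) \<le> length xs + 1"
  by (induction n xs rule: take_t.induct) simp_all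

lemma time_drop_t: "time (drop_t n xs) \<le> length xs + 1"
  by (induction n xs rule: drop_t.induct) simp_all

lemma time_butlast_t: "time (butlast_t xs) \<le> length xs + 1"
  by (induction xs rule: butlast_t.induct) simp_all

lemma time_count_from: "time (count_from k i) = k + 1"
  by (induction k arbitrary: i) simp_all

lemma time_map_t_return: "time (map_t (\<lambda>x. return (f x)) xs) = length xs + 1"
  by (induction xs) simp_all

lemma time_insertions_t: "time (insertions_t x ys) \<le> (length ys + 1) * (length ys + 3)"
proof (induction ys)
  case (Cons y ys)
  then show ?case
    by (simp add: time_map_t_return algebra_simps)
qed simp

section \<open>Refining a partition given as a list of cells\<close>

text \<open>Distinctness of the concatenation expresses at once that the cells are disjoint and that
  none of them repeats a tuple.  The advantage of this form is that, apart from nonemptiness of the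
  cells, it depends on \<open>P\<close> only through the multiset of all tuples, which splitting does not change.\<close>

definition list_partition :: "'a set \<Rightarrow> 'a list list \<Rightarrow> bool" where
  "list_partition X P \<longleftrightarrow> distinct (concat P) \<and> [] \<notin> set P \<and> set (concat P) = X"

definition split_cell :: "'a set \<Rightarrow> 'a list \<Rightarrow> 'a list list" where
  "split_cell S C = (let I = filter (\<lambda>u. u \<in> S) C; D = filter (\<lambda>u. u \<notin> S) C in
     if I = [] then [C] else if D = [] then [I] else [I, D])"

definition refine :: "'a set \<Rightarrow> 'a list list \<Rightarrow> 'a list list" where
  "refine S P = concat (map (split_cell S) P)"

definition replace :: "'a list \<Rightarrow> 'a list list \<Rightarrow> 'a list list \<Rightarrow> 'a list list" where
  "replace C Ds P = concat (map (\<lambda>C'. if set C' = set C then filter (\<lambda>D. D \<noteq> []) Ds else [C']) P)"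

lemma result_eq_tuple_t [simp]: "result (eq_tuple_t u v) \<longleftrightarrow> u = v"
  by (simp add: eq_tuple_t_def list.rel_eq)

lemma result_member_t [simp]: "result (member_t u C) \<longleftrightarrow> u \<in> set C"
  by (auto simp: member_t_def)

lemma result_subset_t [simp]: "result (subset_t C D) \<longleftrightarrow> set C \<subseteq> set D"
  by (auto simp: subset_t_def)

lemma result_set_eq_t [simp]: "result (set_eq_t C D) \<longleftrightarrow> set C = set D"
  by (auto simp: set_eq_t_def)

lemma result_split_t [simp]: "result (split_t S C) = split_cell (set S) C"
  by (simp add: split_t_def split_cell_def inter_t_def diff_t_def Let_def)

lemma result_refine_t [simp]: "result (refine_t S P) = refine (set S) P"
  by (simp add: refine_t_def refine_def)

lemma result_replace_t [simp]: "result (replace_t C Ds P) = replace C Ds P"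
  by (simp add: replace_t_def replace_def if_distrib[of result] cong: if_cong)

lemma list_partition_eqI:
  assumes "list_partition X P" "C \<in> set P" "D \<in> set P" "set C \<inter> set D \<noteq> {}"
  shows "C = D"
  using assms unfolding list_partition_def distinct_concat_iff by blast

lemma list_partition_distinct_cell: "list_partition X P \<Longrightarrow> C \<in> set P \<Longrightarrow> distinct C"
  by (auto simp: list_partition_def distinct_concat_iff)

lemma list_partition_cell_subset: "list_partition X P \<Longrightarrow> C \<in> set P \<Longrightarrow> set C \<subseteq> X"
  by (auto simp: list_partition_def)

lemma list_partition_nonempty: "list_partition X P \<Longrightarrow> C \<in> set P \<Longrightarrow> C \<noteq> []"
  by (auto simp: list_partition_def)

lemma list_partition_covers:
  assumes "list_partition X P" "u \<in> X"
  obtains C where "C \<in> set P" "u \<in> set C"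
  using assms by (auto simp: list_partition_def)

lemma list_partition_inj: "list_partition X P \<Longrightarrow> inj_on set (set P)"
  by (rule inj_onI) (metis inf.idem list_partition_eqI list_partition_nonempty set_empty)

lemma list_partition_distinct: "list_partition X P \<Longrightarrow> distinct P"
  by (auto simp: list_partition_def distinct_concat_iff)

lemma list_partition_encodes: "list_partition X P \<Longrightarrow> encodes P (set ` set P)"
  by (simp add: encodes_def distinct_map list_partition_distinct list_partition_inj
      list_partition_distinct_cell)

lemma list_partition_partition_on: "list_partition X P \<Longrightarrow> partition_on X (set ` set P)"
  by (rule partition_onI)
    (auto simp: disjnt_def elim: list_partition_covers dest: list_partition_cell_subset
      list_partition_nonempty list_partition_eqI)

text \<open>The input is given by \<^const>\<open>encodes\<close>, which says nothing about disjointness or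
  nonemptiness of the cells; these come from the partition that is encoded.\<close>

lemma encodes_list_partition:
  assumes "encodes P \<Gamma>" "partition_on X \<Gamma>"
  shows "list_partition X P"
proof -
  have enc: "set ` set P = \<Gamma>" "distinct P" "inj_on set (set P)" "\<And>C. C \<in> set P \<Longrightarrow> distinct C"
    using assms(1) by (auto simp: encodes_def distinct_map)
  have "[] \<notin> set P"
    using enc(1) partition_onD3[OF assms(2)] by force
  moreover have "set C \<inter> set D = {}" if "C \<in> set P" "D \<in> set P" "C \<noteq> D" for C D
  proof -
    have "set C \<noteq> set D" using that enc(3) by (auto dest: inj_onD)
    then show ?thesis
      using partition_onD2[OF assms(2)] that enc(1) by (auto simp: disjoint_def)
  qed
  moreover have "set (concat P) = X"
    using partition_onD1[OF assms(2)] enc(1) by auto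
  ultimately show ?thesis
    using enc(2,4) by (auto simp: list_partition_def distinct_concat_iff removeAll_id)
qed

lemma list_partition_mset:
  assumes "list_partition X P" "mset (concat P') = mset (concat P)" "[] \<notin> set P'"
  shows "list_partition X P'"
  using assms unfolding list_partition_def by (metis mset_eq_imp_distinct_iff mset_eq_setD)

text \<open>No list of cells or list of tuples is longer than the number of tuples; this is where
  nonemptiness of cells matters for the running time.\<close>

lemma list_partition_length:
  assumes "list_partition X P"
  shows "length P \<le> card X" and "C \<in> set P \<Longrightarrow> length C \<le> card X"
proof -
  have card: "length (concat P) = card X"
    using assms by (auto simp: list_partition_def simp flip: distinct_card)
  have "length Q \<le> length (concat Q)" if "[] \<notin> set Q" for Q :: "'a list list"
    using that
  proof (induction Q)
    case (Cons C Q)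
    then show ?case by (cases C) auto
  qed simp
  with card show "length P \<le> card X"
    using assms by (metis list_partition_def)
  show "length C \<le> card X" if "C \<in> set P"
    using that member_le_sum_list[of "length C" "map length P"] card by (simp add: length_concat)
qed

text \<open>Splitting keeps the tuples of a cell with their multiplicities, so that all properties of a
  list partition are inherited through \<^const>\<open>mset\<close>.\<close>

lemma mset_concat_split_cell: "mset (concat (split_cell S C)) = mset C"
proof -
  have "filter (\<lambda>u. u \<notin> S) C = [] \<Longrightarrow> filter (\<lambda>u. u \<in> S) C = C"
    by (simp add: filter_empty_conv)
  then show ?thesis
    by (auto simp: split_cell_def Let_def)
qed

lemma mset_concat_refine: "mset (concat (refine S P)) = mset (concat P)"
  unfolding refine_def
proof (induction P)
  case (Cons C P)
  then show ?case by (simp add: mset_concat_split_cell)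
qed simp

lemma list_partition_refine:
  assumes "list_partition X P" shows "list_partition X (refine S P)"
proof (rule list_partition_mset[OF assms mset_concat_refine])
  show "[] \<notin> set (refine S P)"
    using assms by (auto simp: refine_def split_cell_def Let_def list_partition_def split: if_splits)
qed

lemma set_refineD:
  assumes "D \<in> set (refine S P)"
  obtains C where "C \<in> set P" "D = C \<or> set D = set C \<inter> S \<or> set D = set C - S"
    "set D \<subseteq> S \<or> set D \<inter> S = {}"
  using assms by (fastforce simp: refine_def split_cell_def Let_def filter_empty_conv split: if_splits)

text \<open>Each cell is left alone or replaced by at least two, so only the trivial update keeps
  the number of cells.\<close>

lemma concat_map_eq_or_longer:
  assumes "\<And>x. x \<in> set xs \<Longrightarrow> f x = [x] \<or> 2 \<le> length (f x)"
  shows "concat (map f xs) = xs \<or> length xs < length (concat (map f xs))"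
  using assms
proof (induction xs)
  case (Cons x xs)
  then have "concat (map f xs) = xs \<or> length xs < length (concat (map f xs))"
    "f x = [x] \<or> 2 \<le> length (f x)"
    by simp_all
  then show ?case by auto
qed simp

lemma refine_eq_or_longer: "refine S P = P \<or> length P < length (refine S P)"
proof -
  have "filter (\<lambda>u. u \<notin> S) C = [] \<Longrightarrow> filter (\<lambda>u. u \<in> S) C = C" for C
    by (simp add: filter_empty_conv)
  then show ?thesis
    unfolding refine_def
    by (intro concat_map_eq_or_longer) (auto simp: split_cell_def Let_def)
qed

lemma mset_concat_filter_nonempty: "mset (concat (filter (\<lambda>D. D \<noteq> []) Ds)) = mset (concat Ds)"
  by (induction Ds) auto

context
  fixes X :: "'a set" and P C Ds
  assumes P: "list_partition X P" and C: "C \<in> set P" and Ds: "mset (concat Ds) = mset C"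
begin

lemma list_partition_replace: "list_partition X (replace C Ds P)"
proof (rule list_partition_mset[OF P])
  have "mset (concat (replace C Ds P')) = mset (concat P')" if "set P' \<subseteq> set P" for P'
    using that
  proof (induction P')
    case (Cons C' P')
    moreover have "C' = C" if "set C' = set C"
      using that Cons.prems C inj_onD[OF list_partition_inj[OF P] that] by simp
    ultimately show ?case
      by (auto simp: replace_def mset_concat_filter_nonempty Ds)
  qed (simp add: replace_def)
  then show "mset (concat (replace C Ds P)) = mset (concat P)" by simp
  show "[] \<notin> set (replace C Ds P)"
    using list_partition_nonempty[OF P] by (auto simp: replace_def split: if_splits)
qed

text \<open>A single nonempty piece has as many tuples as \<open>C\<close>; being obtained from \<open>C\<close> by
  filtering, it is \<open>C\<close> itself, with the tuples in the same order.\<close>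

lemma replace_eq_or_longer:
  assumes filters: "\<And>D. D \<in> set Ds \<Longrightarrow> \<exists>p. D = filter p C"
  shows "replace C Ds P = P \<or> length P < length (replace C Ds P)"
  unfolding replace_def
proof (rule concat_map_eq_or_longer)
  fix C' assume C': "C' \<in> set P"
  let ?Es = "filter (\<lambda>D. D \<noteq> []) Ds"
  have "?Es = [C] \<or> 2 \<le> length ?Es"
  proof (cases ?Es rule: remdups_adj.cases)
    case 1
    with Ds have "mset C = {#}"
      by (metis concat.simps(1) mset.simps(1) mset_concat_filter_nonempty)
    with C P show ?thesis by (auto simp: list_partition_def)
  next
    case (2 E)
    then have "mset E = mset C" 
      using Ds mset_concat_filter_nonempty[of Ds] by simp
    moreover have "E \<in> set Ds" using 2 by (metis filter_is_subset list.set_intros(1) subsetD)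
    then obtain p where "E = filter p C" using filters by blast
    ultimately have "E = C"
      by (metis filter_True filter_id_conv length_filter_less mset_eq_length less_irrefl)
    with 2 show ?thesis by simp
  qed simp
  moreover have "C' = C" if "set C' = set C"
    using inj_onD[OF list_partition_inj[OF P] that C' C] .
  ultimately show "(if set C' = set C then ?Es else [C']) = [C'] \<or>
      2 \<le> length (if set C' = set C then ?Es else [C'])"
    by auto
qed

lemma set_replaceD:
  assumes "D \<in> set (replace C Ds P)"
  shows "D \<in> set Ds \<or> D \<in> set P \<and> D \<noteq> C"
  using assms by (auto simp: replace_def split: if_splits)

lemma other_cells_survive_replace: "set P - {C} \<subseteq> set (replace C Ds P)"
proof
  fix D assume D: "D \<in> set P - {C}"
  then have "set D \<noteq> set C"
    using inj_onD[OF list_partition_inj[OF P] _ _ C] by auto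
  with D show "D \<in> set (replace C Ds P)"
    by (force simp: replace_def)
qed

end

lemma mset_filter_disjoint_Un:
  "(\<And>u. u \<in> set C \<Longrightarrow> \<not> (p u \<and> q u)) \<Longrightarrow>
    mset (filter p C) + mset (filter q C) = mset (filter (\<lambda>u. p u \<or> q u) C)"
  by (induction C) auto

text \<open>The preimages of disjoint cells are disjoint, so that cutting \<open>C\<close> into them repeats no
  tuple.\<close>

lemma mset_concat_vimages:
  assumes "distinct Bs" "\<And>B B'. B \<in> set Bs \<Longrightarrow> B' \<in> set Bs \<Longrightarrow> B \<noteq> B' \<Longrightarrow> set B \<inter> set B' = {}"
  shows "mset (concat (map (\<lambda>B. filter (\<lambda>u. f u \<in> set B) C) Bs)) =
    mset (filter (\<lambda>u. \<exists>B\<in>set Bs. f u \<in> set B) C)"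
  using assms
proof (induction Bs)
  case (Cons B Bs)
  have "\<not> (f u \<in> set B \<and> (\<exists>B'\<in>set Bs. f u \<in> set B'))" for u
    using Cons.prems(2)[of B] Cons.prems(1) by fastforce
  then have "mset (filter (\<lambda>u. f u \<in> set B) C) + mset (filter (\<lambda>u. \<exists>B\<in>set Bs. f u \<in> set B) C) =
      mset (filter (\<lambda>u. f u \<in> set B \<or> (\<exists>B\<in>set Bs. f u \<in> set B)) C)"
    by (rule mset_filter_disjoint_Un)
  with Cons show ?case by simp
qed simp

section \<open>Growth of the number of cells\<close>

text \<open>Every operation of the algorithm either leaves the state literally unchanged or increases the
  number of cells.  Hence a pass that does not change the numbers of cells has not changed anything
  at any moment, and the number of refining passes is at most the largest possible number of cells.\<close>

definition cell_count :: "'a list list \<Rightarrow> nat" where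
  "cell_count G = sum_list (map length G)"

definition grows :: "'a list list \<Rightarrow> 'a list list \<Rightarrow> bool" where
  "grows G G' \<longleftrightarrow> G' = G \<or> cell_count G < cell_count G'"

lemma grows_refl [simp]: "grows G G"
  by (simp add: grows_def)

lemma grows_trans: "grows G G' \<Longrightarrow> grows G' G'' \<Longrightarrow> grows G G''"
  by (auto simp: grows_def)

lemma grows_antisym: "grows G G' \<Longrightarrow> grows G' G \<Longrightarrow> G' = G"
  by (auto simp: grows_def)

lemma cell_count_update:
  "s < length G \<Longrightarrow> cell_count (G[s := P]) + length (G ! s) = cell_count G + length P"
  unfolding cell_count_def
proof (induction G arbitrary: s)
  case (Cons P' G)
  then show ?case by (cases s) auto
qed simp

lemma grows_update:
  assumes "P = G ! s \<or> length (G ! s) < length P" "s < length G"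
  shows "grows G (G[s := P])"
  using assms cell_count_update[OF assms(2), of P] by (auto simp: grows_def)

lemma grows_same_lengths:
  assumes "grows G G'" "list_all2 (\<lambda>P P'. length P = length P') G G'"
  shows "G' = G"
proof -
  have "map length G = map length G'"
    using assms(2) by (simp add: list_all2_conv_all_nth list_eq_iff_nth_eq)
  with assms(1) show ?thesis by (auto simp: grows_def cell_count_def)
qed

lemma list_all2_True_iff [simp]: "list_all2 (\<lambda>x y. True) xs ys \<longleftrightarrow> length xs = length ys"
  by (auto simp: list_all2_conv_all_nth)

text \<open>The bound on the cost is part of the notion because it is available only for states that satisfy
  the invariant.\<close>

definition refining :: "('s list list \<Rightarrow> bool) \<Rightarrow> nat \<Rightarrow> ('s list list \<Rightarrow> 's list list timed) \<Rightarrow> bool" where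
  "refining I k f \<longleftrightarrow> (\<forall>G. I G \<longrightarrow> time (f G) \<le> k \<and> I (result (f G)) \<and> grows G (result (f G)))"

lemma refiningD:
  assumes "refining I k f" "I G"
  shows "time (f G) \<le> k" "I (result (f G))" "grows G (result (f G))"
  using assms by (simp_all add: refining_def)

lemma refining_fold_t:
  assumes "\<And>x. x \<in> set xs \<Longrightarrow> refining I k (f x)"
  shows "refining I (length xs * (k + 1) + 1) (fold_t f xs)"
proof -
  have "time (fold_t f xs G) \<le> length xs * (k + 1) + 1 \<and> I (result (fold_t f xs G)) \<and>
      grows G (result (fold_t f xs G))" if "I G" for G
    using assms that
  proof (induction xs arbitrary: G)
    case (Cons x xs)
    let ?G = "result (f x G)"
    have x: "time (f x G) \<le> k" "I ?G" "grows G ?G"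
      using refiningD[of I k "f x" G] Cons.prems by simp_all
    with Cons.IH[of ?G] Cons.prems show ?case
      by (auto intro: grows_trans)
  qed simp
  then show ?thesis by (simp add: refining_def)
qed

text \<open>By antisymmetry of growth, the state cannot leave its initial value and return to it later.\<close>

lemma fold_t_fixed:
  assumes "\<And>x. x \<in> set xs \<Longrightarrow> refining I k (f x)" "I G"
    and "result (fold_t f xs G) = G" "x \<in> set xs"
  shows "result (f x G) = G"
  using assms
proof (induction xs)
  case (Cons y ys)
  let ?G = "result (f y G)"
  have y: "I ?G" "grows G ?G"
    using refiningD[of I k "f y" G] Cons.prems by simp_all
  have "grows ?G (result (fold_t f ys ?G))"
    using refiningD(3)[OF refining_fold_t, of ys I k f ?G] y(1) Cons.prems by simp
  also have "result (fold_t f ys ?G) = G"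
    using Cons.prems(3) by simp
  finally have "?G = G"
    using y(2) by (blast intro: grows_antisym)
  with Cons show ?case by auto
qed simp

text \<open>The invariant \<open>J\<close> may speak of the cells not yet visited: in step 1 the loop runs over
  cells that must still be present when their turn comes.  The property \<open>fixed\<close> is what a trivial
  round reveals; by antisymmetry of growth, a loop that returns its input had only trivial rounds.\<close>

lemma fold_option_t_invariant:
  assumes step: "\<And>x xs G. J (x # xs) G \<Longrightarrow> time (f x G) \<le> k \<and>
      (case result (f x G) of None \<Rightarrow> bad
       | Some G' \<Rightarrow> J xs G' \<and> grows G G' \<and> (G' = G \<longrightarrow> fixed x G))"
    and "J xs G"
  shows "time (fold_option_t f xs G) \<le> length xs * (k + 1) + 1 \<and>
      (case result (fold_option_t f xs G) of None \<Rightarrow> bad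
       | Some G' \<Rightarrow> J [] G' \<and> grows G G' \<and> (G' = G \<longrightarrow> (\<forall>x\<in>set xs. fixed x G)))"
  using assms(2)
proof (induction xs arbitrary: G)
  case (Cons x xs)
  show ?case
  proof (cases "result (f x G)")
    case None
    then show ?thesis using step[OF Cons.prems] by simp
  next
    case (Some G1)
    then have x: "time (f x G) \<le> k" "J xs G1" "grows G G1" "G1 = G \<Longrightarrow> fixed x G"
      using step[OF Cons.prems] by simp_all
    show ?thesis
      using Cons.IH[OF x(2)] x Some
      by (auto split: option.splits intro: grows_trans dest: grows_antisym)
  qed
qed simp

lemma refining_bind_const:
  assumes "time c \<le> a" "refining I b (f (result c))"
  shows "refining I (a + b) (\<lambda>G. bind_timed c (\<lambda>x. f x G))"
  using assms by (auto simp: refining_def intro: add_mono)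

lemma refining_mono: "refining I a f \<Longrightarrow> a \<le> b \<Longrightarrow> refining I b f"
  by (auto simp: refining_def intro: le_trans)

section \<open>Costs of the building blocks\<close>

locale cost_scale =
  fixes N :: nat
  assumes nine_le: "9 \<le> N"
begin

text \<open>The size conditions under which comparing, searching and filtering a cell is charged a
  fixed power of \<open>N\<close>.\<close>

definition small :: "'a list list \<Rightarrow> bool" where
  "small C \<longleftrightarrow> length C \<le> N \<and> (\<forall>u\<in>set C. length u \<le> N)"

lemma smallD: "small C \<Longrightarrow> length C \<le> N" "small C \<Longrightarrow> u \<in> set C \<Longrightarrow> length u \<le> N"
  by (auto simp: small_def)

lemma power_up: "a \<le> N ^ i \<Longrightarrow> i \<le> j \<Longrightarrow> a \<le> N ^ j"
  using nine_le by (meson le_trans power_increasing one_le_numeral)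

text \<open>No sequence of commands below consists of more than nine parts whose costs are added.\<close>

lemma nine_power: "9 * N ^ j \<le> N ^ (j + 1)"
  using nine_le by simp

lemma one_le_power_N: "1 \<le> N ^ j"
  using nine_le by (simp add: Suc_le_eq)

text \<open>One factor \<open>N\<close> pays for the number of rounds, the other one absorbs the additive
  constants.  All cost bounds below arise by adding 2 to the exponent at each loop and 1 at each
  sequence of commands, the latter by \<open>nine_power\<close>.\<close>

lemma loop_cost:
  assumes "c \<le> l * (k + 1) + 1" "l \<le> N" "k \<le> N ^ j"
  shows "c \<le> N ^ (j + 2)"
proof -
  have "c \<le> N * (N ^ j + 1) + 1"
    using assms by (meson add_le_mono le_trans mult_le_mono order_refl)
  also have "\<dots> \<le> N * (2 * N ^ j) + N * N ^ j"
    using one_le_power_N[of j] nine_le by (intro add_mono mult_mono) (auto simp: Suc_le_eq)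
  also have "\<dots> \<le> N * N * N ^ j"
    using nine_le by simp
  finally show ?thesis by (simp add: power_add power2_eq_square mult.commute)
qed

lemmas map_cost = loop_cost[OF time_map_t _ order_refl]
  and filter_cost = loop_cost[OF time_filter_t _ order_refl]
  and any_cost = loop_cost[OF time_any_t _ order_refl]
  and all_cost = loop_cost[OF time_all_t _ order_refl]
  and all2_cost = loop_cost[OF time_all2_t _ order_refl]

lemma linear_cost: "c \<le> l + 1 \<Longrightarrow> l \<le> N \<Longrightarrow> c \<le> N ^ 2"
  using loop_cost[of c l 0 0] by (simp add: power2_eq_square)

lemmas append_cost = linear_cost[OF time_append_t]
  and nth_cost = linear_cost[OF time_nth_t]
  and update_cost = linear_cost[OF time_update_t]
  and take_cost = linear_cost[OF time_take_t]
  and drop_cost = linear_cost[OF time_drop_t]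
  and butlast_cost = linear_cost[OF time_butlast_t]
  and count_cost = linear_cost[OF eq_imp_le[OF time_count_from]]

lemma concat_cost:
  assumes "length xss \<le> N" "\<And>xs. xs \<in> set xss \<Longrightarrow> length xs \<le> N"
  shows "time (concat_t xss) \<le> N ^ 4"
proof -
  have "time (concat_t xss) \<le> length xss * (N + 1 + 1) + 1"
    using time_concat_t[of xss N] assms(2) by simp
  moreover have "9 * N \<le> N * N"
    using nine_le by simp
  then have "N + 1 \<le> N\<^sup>2"
    using nine_le unfolding power2_eq_square by linarith
  ultimately show ?thesis
    using loop_cost[of _ "length xss" "N + 1" 2] assms(1) by simp
qed

lemma eq_tuple_cost: "length u \<le> N \<Longrightarrow> time (eq_tuple_t u v) \<le> N ^ 2"
  unfolding eq_tuple_t_def by (rule all2_cost[where j = 0, unfolded add_0]) simp_all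

lemma member_cost: "length u \<le> N \<Longrightarrow> length C \<le> N \<Longrightarrow> time (member_t u C) \<le> N ^ 4"
  unfolding member_t_def by (rule any_cost[where j = 2, simplified]) (simp_all add: eq_tuple_cost)

lemma subset_cost: "small C \<Longrightarrow> length D \<le> N \<Longrightarrow> time (subset_t C D) \<le> N ^ 6"
  unfolding subset_t_def
  by (rule all_cost[where j = 4, simplified]) (simp_all add: member_cost smallD)

lemma set_eq_cost: "small C \<Longrightarrow> small D \<Longrightarrow> time (set_eq_t C D) \<le> N ^ 7"
  using subset_cost[of C D] subset_cost[of D C] nine_power[of 6]
  by (simp add: set_eq_t_def time_if smallD)

lemma inter_cost: "small C \<Longrightarrow> length S \<le> N \<Longrightarrow> time (inter_t C S) \<le> N ^ 6"
  unfolding inter_t_def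
  by (rule filter_cost[where j = 4, simplified]) (simp_all add: member_cost smallD)

lemma diff_cost: "small C \<Longrightarrow> length S \<le> N \<Longrightarrow> time (diff_t C S) \<le> N ^ 6"
  unfolding diff_t_def
  by (rule filter_cost[where j = 4, simplified]) (simp_all add: member_cost smallD)

lemma split_cost: "small C \<Longrightarrow> length S \<le> N \<Longrightarrow> time (split_t S C) \<le> N ^ 7"
  using inter_cost[of C S] diff_cost[of C S] nine_power[of 6]
  by (simp add: split_t_def)

lemma refine_cost:
  assumes "length P \<le> N" "\<And>C. C \<in> set P \<Longrightarrow> small C" "length S \<le> N"
  shows "time (refine_t S P) \<le> N ^ 10"
proof -
  have "time (map_t (split_t S) P) \<le> N ^ 9"
    using assms by (intro map_cost[where j = 7, simplified]) (simp_all add: split_cost)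
  moreover have "time (concat_t (map (split_cell (set S)) P)) \<le> N ^ 4"
    using assms nine_le by (intro concat_cost) (auto simp: split_cell_def Let_def)
  then have "time (concat_t (map (split_cell (set S)) P)) \<le> N ^ 9"
    by (rule power_up) simp
  ultimately show ?thesis
    using nine_power[of 9] by (simp add: refine_t_def)
qed

lemma replace_cost:
  assumes "length P \<le> N" "\<And>C. C \<in> set P \<Longrightarrow> small C" "small C" "length Ds \<le> N"
  shows "time (replace_t C Ds P) \<le> N ^ 10"
proof -
  let ?Es = "filter (\<lambda>D. D \<noteq> []) Ds"
  have "time (filter_t (\<lambda>D. return (D \<noteq> [])) Ds) \<le> N ^ 2"
    using assms by (intro filter_cost[where j = 0, unfolded add_0]) simp_all
  then have "time (filter_t (\<lambda>D. return (D \<noteq> [])) Ds) \<le> N ^ 9"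
    by (rule power_up) simp
  moreover have "time (map_t (\<lambda>C'. bind_timed (set_eq_t C' C)
      (\<lambda>b. return (if b then ?Es else [C']))) P) \<le> N ^ 9"
    using assms by (intro map_cost[where j = 7, simplified]) (simp_all add: set_eq_cost)
  moreover have "length ?Es \<le> N"
    using assms(4) length_filter_le[of "\<lambda>D. D \<noteq> []" Ds] by (rule le_trans[rotated])
  then have "time (concat_t (map (\<lambda>C'. if set C' = set C then ?Es else [C']) P)) \<le> N ^ 4"
    using assms nine_le by (intro concat_cost) auto
  then have "time (concat_t (map (\<lambda>C'. if set C' = set C then ?Es else [C']) P)) \<le> N ^ 9"
    by (rule power_up) simp
  ultimately show ?thesis
    using nine_power[of 9] by (simp add: replace_t_def cong: if_cong)
qed

lemma insertions_cost:
  assumes "length ys + 3 \<le> N"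
  shows "time (insertions_t x ys) \<le> N ^ 2"
proof -
  have "(length ys + 1) * (length ys + 3) \<le> N * N"
    using assms by (intro mult_le_mono) simp_all
  then show ?thesis
    using time_insertions_t[of x ys] by (simp add: power2_eq_square)
qed

text \<open>Every intermediate result has at most \<open>fact (length xs)\<close> entries, hence one insertion
  round costs a fixed power of \<open>N\<close>, and there are \<open>length xs\<close> of them.\<close>

lemma permutations_cost:
  assumes "fact (length xs) \<le> N" "length xs + 3 \<le> N"
  shows "time (permutations_t xs) \<le> N ^ 7"
proof -
  have "time (permutations_t xs) \<le> (length xs + 1) * N ^ 5"
    using assms
  proof (induction xs)
    case Nil
    then show ?case using one_le_power_N[of 5] by simp
  next
    case (Cons x xs)
    let ?ps = "result (permutations_t xs)"
    have "fact (length xs) \<le> (fact (length (x # xs)) :: nat)"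
      by (rule fact_mono_nat) simp
    then have fact: "fact (length xs) \<le> N" using Cons.prems by linarith
    have len: "length ys = length xs" if "ys \<in> set ?ps" for ys
      using that by (auto simp: set_result_permutations_t dest: mset_eq_length)
    have "time (map_t (insertions_t x) ?ps) \<le> N ^ 4"
      using Cons.prems fact
      by (intro map_cost[where j = 2, simplified])
        (simp_all add: insertions_cost len length_result_permutations_t)
    moreover have "time (concat_t (map (\<lambda>ys. result (insertions_t x ys)) ?ps)) \<le> N ^ 4"
      using Cons.prems fact by (intro concat_cost) (auto simp: length_result_permutations_t len)
    moreover have "time (permutations_t xs) \<le> (length xs + 1) * N ^ 5"
      using Cons fact by simp
    ultimately show ?case
      using nine_power[of 4] one_le_power_N[of 4] by (simp add: algebra_simps)
  qed
  also have "\<dots> \<le> N * N ^ 5"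
    using assms by (intro mult_le_mono1) simp
  also have "\<dots> = N ^ 6"
    by (simp add: numeral_eq_Suc)
  finally show ?thesis by (rule power_up) simp
qed

lemma tuples_cost:
  assumes "length qs ^ n \<le> N" "length qs \<le> N" "n + 1 \<le> N" "1 \<le> length qs"
  shows "time (tuples_t qs n) \<le> N ^ 7"
proof -
  have "time (tuples_t qs n) \<le> (n + 1) * N ^ 5"
    using assms
  proof (induction n)
    case 0
    then show ?case using one_le_power_N[of 5] by simp
  next
    case (Suc n)
    let ?us = "result (tuples_t qs n)"
    have "length qs ^ n \<le> length qs ^ Suc n"
      using Suc.prems by simp
    with Suc.prems(1) have pow: "length qs ^ n \<le> N" by (rule le_trans[rotated])
    then have us: "length ?us \<le> N"
      by (simp add: length_result_tuples_t)
    have "time (map_t (\<lambda>q. map_t (\<lambda>u. return (q # u)) ?us) qs) \<le> N ^ 4"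
      using Suc.prems us
      by (intro map_cost[where j = 2, simplified])
        (simp_all add: time_map_t_return linear_cost[OF order_refl, simplified])
    moreover have "time (concat_t (map (\<lambda>q. map ((#) q) ?us) qs)) \<le> N ^ 4"
      using Suc.prems us by (intro concat_cost) auto
    moreover have "time (tuples_t qs n) \<le> (n + 1) * N ^ 5"
      using Suc pow by simp
    ultimately show ?case
      using nine_power[of 4] one_le_power_N[of 4] by (simp add: algebra_simps)
  qed
  also have "\<dots> \<le> N * N ^ 5"
    using assms by (intro mult_le_mono1) simp
  also have "\<dots> = N ^ 6"
    by (simp add: numeral_eq_Suc)
  finally show ?thesis by (rule power_up) simp
qed

lemma power_add_up: "a \<le> N ^ j \<Longrightarrow> b \<le> N ^ j \<Longrightarrow> a + b \<le> N ^ (j + 1)"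
  using nine_power[of j] by linarith

lemma refining_loop:
  assumes "length xs \<le> N" "\<And>x. x \<in> set xs \<Longrightarrow> refining I (N ^ j) (f x)"
  shows "refining I (N ^ (j + 2)) (fold_t f xs)"
  by (rule refining_mono[OF refining_fold_t[OF assms(2)] loop_cost[OF order_refl assms(1) order_refl]])

end

section \<open>Sets that every extension must respect\<close>

lemma card_tuples: "finite Q \<Longrightarrow> card (tuples Q n) = card Q ^ n"
  and finite_tuples: "finite Q \<Longrightarrow> finite (tuples Q n)"
  using card_lists_length_eq[of Q n] finite_lists_length_eq[of Q n]
  by (simp_all add: tuples_def conj_commute)

lemma permute_list_in_tuples:
  "p permutes {..<n} \<Longrightarrow> u \<in> tuples Q n \<Longrightarrow> permute_list p u \<in> tuples Q n"
  by (auto simp: tuples_def)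

lemma permute_list_inverse:
  assumes "p permutes {..<n}" "length u = n"
  shows "permute_list (inv p) (permute_list p u) = u"
  using permute_list_compose[of "inv p" u p] permutes_inv[OF assms(1)] permutes_inv_o(1)[OF assms(1)] assms(2)
  by (simp add: permute_list_id)

lemma permute_list_upt:
  assumes "p permutes {..<n}"
  shows "permute_list p [0..<n] = map p [0..<n]"
  using permutes_in_image[OF assms] by (simp add: permute_list_def)

lemma partition_on_unique: "partition_on X \<P> \<Longrightarrow> A \<in> \<P> \<Longrightarrow> B \<in> \<P> \<Longrightarrow> A \<inter> B \<noteq> {} \<Longrightarrow> A = B"
  by (meson disjointD partition_onD2)

text \<open>The entry at \<open>w\<close> of the inner product of the adjacency tensors of \<open>A\<close> and \<open>B\<close>, the first
  of which has \<open>k + 1\<close> indices.\<close>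

definition inner_entry :: "'a set \<Rightarrow> nat \<Rightarrow> 'a list set \<Rightarrow> 'a list set \<Rightarrow> 'a list \<Rightarrow> nat" where
  "inner_entry Q k A B w = card {z \<in> Q. take k w @ [z] \<in> A \<and> z # drop k w \<in> B}"

locale extension_problem =
  fixes d t :: nat and \<Gamma> :: "(nat \<times> nat) set set" and P0 :: cells
  assumes scheme: "association_scheme {1..d} \<Gamma>"
    and P0: "encodes P0 (pair_tuples \<Gamma>)"
    and t_ge_1: "1 \<le> t" and t_le: "t + 2 \<le> d"
begin

abbreviation Q :: "nat set" where "Q \<equiv> {1..d}"

definition extends :: "(nat \<Rightarrow> tuple set set) \<Rightarrow> bool" where
  "extends H \<longleftrightarrow> prescheme Q t H \<and> H 0 = pair_tuples \<Gamma>"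

lemma extensible_iff: "extensible Q \<Gamma> t \<longleftrightarrow> (\<exists>H. extends H)"
  by (simp add: extensible_def extends_def)

text \<open>If there is no extension, every set is forced; so one invariant serves both halves of
  correctness.\<close>

definition forced :: "nat \<Rightarrow> tuple set \<Rightarrow> bool" where
  "forced s S \<longleftrightarrow> (\<forall>H. extends H \<longrightarrow> (\<forall>X\<in>H s. X \<subseteq> S \<or> X \<inter> S = {}))"

lemma forcedI: "(\<And>H X u. extends H \<Longrightarrow> X \<in> H s \<Longrightarrow> u \<in> X \<Longrightarrow> u \<in> S \<Longrightarrow> X \<subseteq> S) \<Longrightarrow> forced s S"
  by (auto simp: forced_def)

lemma forcedD: "forced s S \<Longrightarrow> extends H \<Longrightarrow> X \<in> H s \<Longrightarrow> u \<in> X \<Longrightarrow> u \<in> S \<Longrightarrow> X \<subseteq> S"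
  by (auto simp: forced_def)

lemma forced_Int: "forced s S \<Longrightarrow> forced s S' \<Longrightarrow> forced s (S \<inter> S')"
  unfolding forced_def by blast

lemma forced_Diff: "forced s S \<Longrightarrow> forced s S' \<Longrightarrow> forced s (S - S')"
  unfolding forced_def by blast

lemma forced_empty: "forced s {}"
  by (simp add: forced_def)

lemma extends_partition: "extends H \<Longrightarrow> n \<le> t \<Longrightarrow> partition_on (tuples Q (n + 2)) (H n)"
  by (simp add: extends_def prescheme_def)

lemma extends_unique:
  "extends H \<Longrightarrow> n \<le> t \<Longrightarrow> X \<in> H n \<Longrightarrow> Y \<in> H n \<Longrightarrow> u \<in> X \<Longrightarrow> u \<in> Y \<Longrightarrow> X = Y"
  using partition_on_unique[OF extends_partition] by blast

lemma extends_covers: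
  assumes "extends H" "n \<le> t" "u \<in> tuples Q (n + 2)"
  obtains X where "X \<in> H n" "u \<in> X"
  using assms partition_onD1[OF extends_partition] by blast

lemma extends_pr: "extends H \<Longrightarrow> 1 \<le> n \<Longrightarrow> n \<le> t \<Longrightarrow> X \<in> H n \<Longrightarrow> butlast ` X \<in> H (n - 1)"
  by (simp add: extends_def prescheme_def)

lemma extends_permute:
  "extends H \<Longrightarrow> n \<le> t \<Longrightarrow> X \<in> H n \<Longrightarrow> p permutes {..<n + 2} \<Longrightarrow> permute_list p ` X \<in> H n"
  by (simp add: extends_def prescheme_def)

text \<open>If a cell of an extension meets the projection of \<open>C\<close>, it is the projection of a cell
  meeting \<open>C\<close>, which lies inside \<open>C\<close>.\<close>

lemma forced_pr:
  assumes "1 \<le> s" "s \<le> t" "C \<subseteq> tuples Q (s + 2)" "forced s C"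
  shows "forced (s - 1) (butlast ` C)"
proof (rule forcedI)
  fix H X v assume H: "extends H" and X: "X \<in> H (s - 1)" "v \<in> X" "v \<in> butlast ` C"
  then obtain u where u: "u \<in> C" "v = butlast u" by blast
  then obtain Y where Y: "Y \<in> H s" "u \<in> Y"
    using extends_covers[OF H] assms by blast
  then have "butlast ` Y \<in> H (s - 1)" "v \<in> butlast ` Y"
    using extends_pr[OF H assms(1,2)] u by auto
  then have "butlast ` Y = X"
    using extends_unique[OF H _ _ X(1) _ X(2)] assms(2) by simp
  then show "X \<subseteq> butlast ` C"
    using forcedD[OF assms(4) H Y u(1)] by blast
qed

text \<open>The projection of a cell is a cell, hence inside \<open>B\<close> or disjoint from it.\<close>

lemma forced_pr_vimage:
  assumes "1 \<le> s" "s \<le> t" "forced s C" "forced (s - 1) B"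
  shows "forced s {u \<in> C. butlast u \<in> B}"
proof (rule forcedI)
  fix H X u assume H: "extends H" and X: "X \<in> H s" "u \<in> X" "u \<in> {u \<in> C. butlast u \<in> B}"
  then have "butlast u \<in> butlast ` X" "u \<in> C" "butlast u \<in> B" by simp_all
  then have "X \<subseteq> C" "butlast ` X \<subseteq> B"
    using forcedD[OF assms(3) H X(1,2)] forcedD[OF assms(4) H extends_pr[OF H assms(1,2) X(1)]]
    by simp_all
  then show "X \<subseteq> {u \<in> C. butlast u \<in> B}" by auto
qed

text \<open>Rearranging the coordinates maps the cells of an extension to cells.\<close>

lemma forced_permute:
  assumes "s \<le> t" "C \<subseteq> tuples Q (s + 2)" "forced s C" "p permutes {..<s + 2}"
  shows "forced s (permute_list p ` C)"
proof (rule forcedI)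
  fix H X v assume H: "extends H" and X: "X \<in> H s" "v \<in> X" "v \<in> permute_list p ` C"
  then obtain u where u: "u \<in> C" "v = permute_list p u" by blast
  then obtain Y where Y: "Y \<in> H s" "u \<in> Y"
    using extends_covers[OF H] assms by blast
  then have "permute_list p ` Y \<in> H s" "v \<in> permute_list p ` Y"
    using extends_permute[OF H assms(1) _ assms(4)] u by auto
  then have "permute_list p ` Y = X"
    using extends_unique[OF H assms(1) _ X(1) _ X(2)] by simp
  then show "X \<subseteq> permute_list p ` C"
    using forcedD[OF assms(3) H Y u(1)] by blast
qed

text \<open>The points counted by an entry are distributed over the pairs of a cell inside \<open>A\<close> and a cell
  inside \<open>B\<close>; for each such pair their number is the same at all tuples of a cell.\<close>

lemma extends_inner_entry:
  assumes H: "extends H" and s: "s \<le> t" "m \<le> s" and X: "X \<in> H s" "u \<in> X" "v \<in> X"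
    and A: "forced m A" "A \<subseteq> tuples Q (m + 2)" and B: "forced (s - m) B" "B \<subseteq> tuples Q (s - m + 2)"
  shows "inner_entry Q (m + 1) A B u = inner_entry Q (m + 1) A B v"
proof -
  \<comment> \<open>The pairs of cells into which \<open>A\<close> and \<open>B\<close> decompose.\<close>
  define K where "K = {A' \<in> H m. A' \<subseteq> A} \<times> {B' \<in> H (s - m). B' \<subseteq> B}"
  define Z where "Z w = (\<lambda>(A', B'). {z \<in> Q. take (m + 1) w @ [z] \<in> A' \<and> z # drop (m + 1) w \<in> B'})"
    for w :: tuple
  have part: "partition_on (tuples Q (m + 2)) (H m)" "partition_on (tuples Q (s - m + 2)) (H (s - m))"
    using extends_partition[OF H] s by auto
  have finK: "finite K"
    unfolding K_def
    using finite_elements[OF finite_tuples part(1)] finite_elements[OF finite_tuples part(2)] by simp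
  have entry: "inner_entry Q (m + 1) A B w = (\<Sum>k\<in>K. card (Z w k))" for w
  proof -
    have cover: "\<exists>Y\<in>H n. Y \<subseteq> S \<and> x \<in> Y"
      if S: "forced n S" "S \<subseteq> tuples Q (n + 2)" "n \<le> t" "x \<in> S" for n S x
    proof -
      have "x \<in> tuples Q (n + 2)" using S by auto
      then obtain Y where Y: "Y \<in> H n" "x \<in> Y"
        using extends_covers[OF H S(3)] by metis
      moreover have "Y \<subseteq> S" using forcedD[OF S(1) H Y S(4)] .
      ultimately show ?thesis by metis
    qed
    have covA: "\<exists>A'\<in>H m. A' \<subseteq> A \<and> x \<in> A'" if "x \<in> A" for x
      using cover[OF A] s that by simp
    have covB: "\<exists>B'\<in>H (s - m). B' \<subseteq> B \<and> x \<in> B'" if "x \<in> B" for x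
      using cover[OF B] s that by simp
    have "{z \<in> Q. take (m + 1) w @ [z] \<in> A \<and> z # drop (m + 1) w \<in> B} = (\<Union>k\<in>K. Z w k)"
    proof (intro subset_antisym subsetI)
      fix z assume z: "z \<in> {z \<in> Q. take (m + 1) w @ [z] \<in> A \<and> z # drop (m + 1) w \<in> B}"
      then obtain A' B' where "A' \<in> H m" "A' \<subseteq> A" "take (m + 1) w @ [z] \<in> A'"
        "B' \<in> H (s - m)" "B' \<subseteq> B" "z # drop (m + 1) w \<in> B'"
        using covA covB by blast
      with z show "z \<in> (\<Union>k\<in>K. Z w k)"
        by (intro UN_I[of "(A', B')"]) (simp_all add: K_def Z_def)
    qed (auto simp: K_def Z_def)
    moreover have "Z w k \<inter> Z w k' = {}" if kk: "k \<in> K" "k' \<in> K" "k \<noteq> k'" for k k'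
    proof -
      obtain A1 B1 A2 B2 where k: "k = (A1, B1)" "k' = (A2, B2)" by fastforce
      then consider "A1 \<noteq> A2" | "B1 \<noteq> B2" using kk by blast
      then show ?thesis
      proof cases
        case 1
        then have "A1 \<inter> A2 = {}"
          using partition_on_unique[OF part(1)] kk k by (auto simp: K_def)
        then show ?thesis by (auto simp: k Z_def)
      next
        case 2
        then have "B1 \<inter> B2 = {}"
          using partition_on_unique[OF part(2)] kk k by (auto simp: K_def)
        then show ?thesis by (auto simp: k Z_def)
      qed
    qed
    then have "card (\<Union>k\<in>K. Z w k) = (\<Sum>k\<in>K. card (Z w k))"
      by (intro card_UN_disjoint[OF finK]) (auto simp: Z_def)
    ultimately show ?thesis by (simp add: inner_entry_def)
  qed
  have const: "\<exists>c. \<forall>x y. length x = m' + 1 \<and> length y = n + 1 \<and> x @ y \<in> C' \<longrightarrow>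
      card {z \<in> Q. x @ [z] \<in> A' \<and> z # y \<in> B'} = c"
    if "m' + n \<le> t" "A' \<in> H m'" "B' \<in> H n" "C' \<in> H (m' + n)" for m' n A' B' C'
    using H that unfolding extends_def prescheme_def by simp
  have "card (Z u k) = card (Z v k)" if k: "k \<in> K" for k
  proof -
    obtain A' B' where k': "k = (A', B')" "A' \<in> H m" "B' \<in> H (s - m)"
      using k by (auto simp: K_def)
    have "m + (s - m) = s" using s by simp
    then have "\<exists>c. \<forall>x y. length x = m + 1 \<and> length y = s - m + 1 \<and> x @ y \<in> X \<longrightarrow>
        card {z \<in> Q. x @ [z] \<in> A' \<and> z # y \<in> B'} = c"
      using k'(2,3) s(1) X(1) by (intro const) (simp_all only:)
    then obtain c where c: "\<forall>x y. length x = m + 1 \<and> length y = s - m + 1 \<and> x @ y \<in> X \<longrightarrow>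
        card {z \<in> Q. x @ [z] \<in> A' \<and> z # y \<in> B'} = c"
      by (elim exE)
    have "card (Z w k) = c" if "w \<in> X" for w
    proof -
      have "length w = s + 2"
        using that partition_onD1[OF extends_partition[OF H s(1)]] X(1) by (auto simp: tuples_def)
      then show ?thesis
        using c[rule_format, of "take (m + 1) w" "drop (m + 1) w"] that s(2)
        by (simp add: Z_def k'(1))
    qed
    then show ?thesis using X by simp
  qed
  then show ?thesis unfolding entry by (intro sum.cong) simp_all
qed

lemma forced_inner_entry:
  assumes "s \<le> t" "m \<le> s" "forced m A" "A \<subseteq> tuples Q (m + 2)"
    "forced (s - m) B" "B \<subseteq> tuples Q (s - m + 2)"
  shows "forced s {w \<in> tuples Q (s + 2). inner_entry Q (m + 1) A B w = r}"
proof (rule forcedI)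
  fix H X u
  assume H: "extends H" and X: "X \<in> H s" "u \<in> X"
    and u: "u \<in> {w \<in> tuples Q (s + 2). inner_entry Q (m + 1) A B w = r}"
  have "X \<subseteq> tuples Q (s + 2)"
    using partition_onD1[OF extends_partition[OF H assms(1)]] X(1) by auto
  moreover have "inner_entry Q (m + 1) A B v = inner_entry Q (m + 1) A B u" if "v \<in> X" for v
    using extends_inner_entry[OF H assms(1,2) X(1) that X(2) assms(3-6)] .
  ultimately show "X \<subseteq> {w \<in> tuples Q (s + 2). inner_entry Q (m + 1) A B w = r}"
    using u by auto
qed

section \<open>The invariant\<close>

text \<open>The number of tuples of the top level.\<close>

definition N :: nat where "N = d ^ (t + 2)"

lemma d_ge_3: "3 \<le> d"
  using t_ge_1 t_le by simp

lemma power_d_le_N: "n \<le> t + 2 \<Longrightarrow> d ^ n \<le> N"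
  unfolding N_def using d_ge_3 by (intro power_increasing) auto

lemma d_add_6_le_N: "d + 6 \<le> N"
proof -
  \<comment> \<open>The summand 6 leaves room for the counters and one more coordinate in a tuple.\<close>
  have "3 * d \<le> d * d" using d_ge_3 by simp
  also have "d * d \<le> N" using power_d_le_N[of 2] by (simp add: power2_eq_square)
  finally show ?thesis using d_ge_3 by linarith
qed

text \<open>Because of \<open>t + 2 \<le> d\<close>, a level has at least as many tuples as permutations of
  coordinates.\<close>

lemma fact_le_N: "n \<le> t + 2 \<Longrightarrow> fact n \<le> N"
proof -
  assume n: "n \<le> t + 2"
  have "fact n \<le> n ^ n" using fact_le_power[of n, where 'a = nat] by simp
  also have "\<dots> \<le> d ^ n" using n t_le by (intro power_mono) simp_all
  also have "\<dots> \<le> N" using n by (rule power_d_le_N)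
  finally show ?thesis .
qed

sublocale cost_scale N
  using d_add_6_le_N d_ge_3 by unfold_locales simp

lemma pair_tuples_partition: "partition_on (tuples Q 2) (pair_tuples \<Gamma>)"
proof -
  have part: "partition_on (Q \<times> Q) \<Gamma>"
    using scheme by (simp add: association_scheme_def)
  have "inj_on (\<lambda>(x, y). [x, y]) (Q \<times> Q)"
    by (auto simp: inj_on_def)
  then have "partition_on ((\<lambda>(x, y). [x, y]) ` (Q \<times> Q)) ((`) (\<lambda>(x, y). [x, y]) ` \<Gamma> - {{}})"
    by (rule partition_on_inj_image[OF part])
  moreover have "(`) (\<lambda>(x, y). [x, y]) ` \<Gamma> - {{}} = (`) (\<lambda>(x, y). [x, y]) ` \<Gamma>"
    using partition_onD3[OF part] by auto
  moreover have "u \<in> (\<lambda>(x, y). [x, y]) ` (Q \<times> Q)" if "length u = 2" "set u \<subseteq> Q" for u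
    using that by (auto simp: length_Suc_conv numeral_2_eq_2)
  then have "(\<lambda>(x, y). [x, y]) ` (Q \<times> Q) = tuples Q 2"
    by (auto simp: tuples_def)
  moreover have "{[x, y] | x y. (x, y) \<in> C} = (\<lambda>(x, y). [x, y]) ` C" for C :: "(nat \<times> nat) set"
    by auto
  ultimately show ?thesis by (simp add: pair_tuples_def)
qed

lemma P0_partition: "list_partition (tuples Q 2) P0"
  using encodes_list_partition[OF P0 pair_tuples_partition] .

lemma set_P0: "set ` set P0 = pair_tuples \<Gamma>"
  using P0 by (simp add: encodes_def)

text \<open>The level 0 is the input itself: no step touches it.\<close>

definition invariant :: "state \<Rightarrow> bool" where
  "invariant G \<longleftrightarrow> length G = Suc t \<and> G ! 0 = P0 \<and>
     (\<forall>s\<le>t. list_partition (tuples Q (s + 2)) (G ! s) \<and> (\<forall>C\<in>set (G ! s). forced s (set C)))"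

text \<open>An extension has exactly the given relations as its cells of level 0.\<close>

lemma forced_P0: "C \<in> set P0 \<Longrightarrow> forced 0 (set C)"
proof (rule forcedI)
  fix H X u assume "C \<in> set P0" "extends H" "X \<in> H 0" "u \<in> X" "u \<in> set C"
  then show "X \<subseteq> set C"
    using extends_unique[of H 0 X "set C" u] set_P0 by (auto simp: extends_def)
qed

context
  fixes G assumes G: "invariant G"
begin

lemma length_state: "length G = Suc t"
  using G by (simp add: invariant_def)

lemma level_partition: "s \<le> t \<Longrightarrow> list_partition (tuples Q (s + 2)) (G ! s)"
  using G by (simp add: invariant_def)

lemma cell_forced: "s \<le> t \<Longrightarrow> C \<in> set (G ! s) \<Longrightarrow> forced s (set C)"
  using G by (simp add: invariant_def)

lemma cell_subset: "s \<le> t \<Longrightarrow> C \<in> set (G ! s) \<Longrightarrow> set C \<subseteq> tuples Q (s + 2)"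
  using list_partition_cell_subset[OF level_partition] .

lemma level_length: "s \<le> t \<Longrightarrow> length (G ! s) \<le> N"
  using list_partition_length(1)[OF level_partition, of s] power_d_le_N[of "s + 2"]
  by (simp add: card_tuples)

lemma cell_small:
  assumes "s \<le> t" "C \<in> set (G ! s)"
  shows "small C"
proof -
  have "length C \<le> N"
    using list_partition_length(2)[OF level_partition assms(2)] power_d_le_N[of "s + 2"] assms(1)
    by (simp add: card_tuples)
  then show ?thesis
    using cell_subset[OF assms] assms(1) t_le d_add_6_le_N by (auto simp: small_def tuples_def)
qed

lemma state_nth_cost: "time (nth_t G s) \<le> N ^ 2" and state_update_cost: "time (update_t G s P) \<le> N ^ 2"
  using t_le d_add_6_le_N length_state by (auto intro: nth_cost update_cost)

lemma invariant_update:
  assumes "1 \<le> s" "s \<le> t" "list_partition (tuples Q (s + 2)) P" "\<And>C. C \<in> set P \<Longrightarrow> forced s (set C)"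
  shows "invariant (G[s := P])"
  using G assms by (auto simp: invariant_def nth_list_update)

lemma cell_count_le: "cell_count G \<le> N ^ 2"
proof -
  have "cell_count G \<le> sum_list (map (\<lambda>_. N) G)"
    unfolding cell_count_def
    using level_length length_state by (intro sum_list_mono) (auto simp: in_set_conv_nth less_Suc_eq_le)
  also have "\<dots> = Suc t * N"
    by (simp add: sum_list_triv length_state)
  also have "\<dots> \<le> N * N"
    using t_le d_add_6_le_N by (intro mult_le_mono1) linarith
  finally show ?thesis by (simp add: power2_eq_square)
qed

end

lemma result_refine_level_t:
  "length G = Suc t \<Longrightarrow> s \<le> t \<Longrightarrow> result (refine_level_t s S G) = G[s := refine (set S) (G ! s)]"
  by (simp add: refine_level_t_def)

text \<open>The only update used by steps 2 and 3, and by step 1 on the level below.\<close>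

lemma refining_refine_level:
  assumes s: "1 \<le> s" "s \<le> t" and S: "length S \<le> N" "forced s (set S)"
  shows "refining invariant (N ^ 11) (refine_level_t s S)"
  unfolding refining_def
proof (intro allI impI conjI)
  fix G assume G: "invariant G"
  have res: "result (refine_level_t s S G) = G[s := refine (set S) (G ! s)]"
    using result_refine_level_t[OF length_state[OF G]] s by simp
  have "forced s (set C)" if "C \<in> set (refine (set S) (G ! s))" for C
    using that by (rule set_refineD)
      (auto dest!: cell_forced[OF G s(2)] simp: forced_Int forced_Diff S(2) forced_empty)
  then show "invariant (result (refine_level_t s S G))"
    unfolding res
    by (intro invariant_update[OF G s] list_partition_refine level_partition[OF G s(2)])
  show "grows G (result (refine_level_t s S G))"
    unfolding res using s length_state[OF G] refine_eq_or_longer by (intro grows_update) auto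
  have "time (refine_t S (G ! s)) \<le> N ^ 10"
    using s S G by (intro refine_cost) (auto intro: level_length cell_small)
  moreover have "time (nth_t G s) \<le> N ^ 10" "time (update_t G s (refine (set S) (G ! s))) \<le> N ^ 10"
    using power_up[OF state_nth_cost[OF G]] power_up[OF state_update_cost[OF G]] by simp_all
  ultimately show "time (refine_level_t s S G) \<le> N ^ 11"
    using nine_power[of 10] s length_state[OF G] by (simp add: refine_level_t_def)
qed

text \<open>All cells of a refined level lie inside the set along which it was cut or outside.\<close>

lemma refine_level_fixed:
  assumes "invariant G" "s \<le> t" "result (refine_level_t s S G) = G" "C \<in> set (G ! s)"
  shows "set C \<subseteq> set S \<or> set C \<inter> set S = {}"
proof -
  have "G[s := refine (set S) (G ! s)] ! s = G ! s"
    using assms(3) unfolding result_refine_level_t[OF length_state[OF assms(1)] assms(2)] by simp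
  then have "C \<in> set (refine (set S) (G ! s))"
    using assms(2,4) length_state[OF assms(1)] by simp
  then show ?thesis by (rule set_refineD)
qed

section \<open>Splitting by projections (step 1)\<close>

text \<open>The cells of the level below whose union is the projection of \<open>C\<close>, if that is a union
  of cells at all.\<close>

definition cells_below :: "nat \<Rightarrow> cell \<Rightarrow> state \<Rightarrow> cells" where
  "cells_below s C G = filter (\<lambda>B. set B \<subseteq> butlast ` set C) (G ! (s - 1))"

definition pieces :: "nat \<Rightarrow> cell \<Rightarrow> state \<Rightarrow> cells" where
  "pieces s C G = map (\<lambda>B. filter (\<lambda>u. butlast u \<in> set B) C) (cells_below s C G)"

definition covered :: "nat \<Rightarrow> cell \<Rightarrow> state \<Rightarrow> bool" where
  "covered s C G \<longleftrightarrow> (\<forall>v\<in>butlast ` set C. \<exists>B\<in>set (cells_below s C G). v \<in> set B)"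

context
  fixes G :: state and s :: nat and C :: cell
  assumes G: "invariant G" and s: "1 \<le> s" "s \<le> t" and C: "C \<in> set (G ! s)"
begin

lemma below_le: "s - 1 \<le> t" "s - 1 + 2 = s + 1"
  using s by auto

lemma pr_subset: "butlast ` set C \<subseteq> tuples Q (s - 1 + 2)"
  using cell_subset[OF G s(2) C] s by (force simp: tuples_def dest: in_set_butlastD)

lemma pr_forced: "forced (s - 1) (butlast ` set C)"
  using forced_pr[OF s cell_subset[OF G s(2) C] cell_forced[OF G s(2) C]] .

lemma result_step1_cell:
  "result (step1_cell s C G) =
     (if covered s C G then Some (G[s := replace C (pieces s C G) (G ! s)])
      else if s > 1 then Some (G[s - 1 := refine (butlast ` set C) (G ! (s - 1))])
      else None)"
  using s length_state[OF G]
  by (auto simp: step1_cell_def pr_t_def inter_pr_vimage_t_def covered_def cells_below_def pieces_def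
      result_refine_level_t) blast

lemma mset_pieces:
  assumes "covered s C G"
  shows "mset (concat (pieces s C G)) = mset C"
proof -
  have part: "list_partition (tuples Q (s - 1 + 2)) (G ! (s - 1))"
    by (rule level_partition[OF G below_le(1)])
  have "mset (concat (pieces s C G)) =
      mset (filter (\<lambda>u. \<exists>B\<in>set (cells_below s C G). butlast u \<in> set B) C)"
    unfolding pieces_def
  proof (rule mset_concat_vimages)
    show "distinct (cells_below s C G)"
      using list_partition_distinct[OF part] by (simp add: cells_below_def)
    show "set B \<inter> set B' = {}"
      if "B \<in> set (cells_below s C G)" "B' \<in> set (cells_below s C G)" "B \<noteq> B'" for B B'
      using that list_partition_eqI[OF part, of B B'] by (auto simp: cells_below_def)
  qed
  also have "filter (\<lambda>u. \<exists>B\<in>set (cells_below s C G). butlast u \<in> set B) C = C"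
    using assms by (simp add: covered_def)
  finally show ?thesis .
qed

lemma step1_cell_cost: "time (step1_cell s C G) \<le> N ^ 13"
proof -
  have small: "small C" by (rule cell_small[OF G s(2) C])
  let ?R = "map butlast C" and ?below = "G ! (s - 1)" and ?Bs = "cells_below s C G"
  have R: "small ?R"
    using small by (auto simp: small_def intro: le_trans[OF diff_le_self])
  have below: "length ?below \<le> N" "\<And>B. B \<in> set ?below \<Longrightarrow> small B"
    using level_length[OF G below_le(1)] cell_small[OF G below_le(1)] by simp_all
  have Bs: "length ?Bs \<le> N" "\<And>B. B \<in> set ?Bs \<Longrightarrow> small B"
    using le_trans[OF length_filter_le below(1)] below(2) by (simp_all add: cells_below_def)
  have "time (pr_t C) \<le> N ^ 4"
    unfolding pr_t_def using small
    by (intro map_cost[where j = 2, simplified]) (auto simp: smallD intro: butlast_cost)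
  then have 1: "time (pr_t C) \<le> N ^ 12" by (rule power_up) simp
  have 2: "time (nth_t G r) \<le> N ^ 12" for r
    by (rule power_up[OF state_nth_cost[OF G]]) simp
  have "time (filter_t (\<lambda>B. subset_t B ?R) ?below) \<le> N ^ 8"
    using below R
    by (intro filter_cost[where j = 6, simplified]) (auto intro: subset_cost simp: smallD(1)[of ?R, simplified])
  then have 3: "time (filter_t (\<lambda>B. subset_t B ?R) ?below) \<le> N ^ 12" by (rule power_up) simp
  have "time (any_t (member_t u) ?Bs) \<le> N ^ 6" if "u \<in> set ?R" for u
    using Bs smallD(2)[OF R that]
    by (intro any_cost[where j = 4, simplified]) (auto intro: member_cost smallD(1))
  then have "time (all_t (\<lambda>u. any_t (member_t u) ?Bs) ?R) \<le> N ^ 8"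
    using smallD(1)[OF R] by (intro all_cost[where j = 6, simplified])
  then have 4: "time (all_t (\<lambda>u. any_t (member_t u) ?Bs) ?R) \<le> N ^ 12" by (rule power_up) simp
  have "time (bind_timed (butlast_t u) (\<lambda>v. member_t v B)) \<le> N ^ 5"
    if u: "u \<in> set C" and B: "B \<in> set ?Bs" for u B
  proof -
    have "length u \<le> N" using smallD(2)[OF small u] .
    then have "time (butlast_t u) \<le> N ^ 4" "time (member_t (butlast u) B) \<le> N ^ 4"
      using smallD(1)[OF Bs(2)[OF B]] power_up[OF butlast_cost, of u 4] by (simp_all add: member_cost)
    then show ?thesis using nine_power[of 4] by simp
  qed
  then have "time (inter_pr_vimage_t C B) \<le> N ^ 7" if "B \<in> set ?Bs" for B
    using that smallD(1)[OF small] unfolding inter_pr_vimage_t_def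
    by (intro filter_cost[where j = 5, simplified]) auto
  then have "time (map_t (inter_pr_vimage_t C) ?Bs) \<le> N ^ 9"
    using Bs by (intro map_cost[where j = 7, simplified]) auto
  then have 5: "time (map_t (inter_pr_vimage_t C) ?Bs) \<le> N ^ 12" by (rule power_up) simp
  have "length (pieces s C G) \<le> N" using Bs(1) by (simp add: pieces_def)
  then have "time (replace_t C (pieces s C G) (G ! s)) \<le> N ^ 10"
    using level_length[OF G s(2)] cell_small[OF G s(2)] small by (intro replace_cost) auto
  then have 6: "time (replace_t C (pieces s C G) (G ! s)) \<le> N ^ 12" by (rule power_up) simp
  have 7: "time (update_t G s P) \<le> N ^ 12" for P
    by (rule power_up[OF state_update_cost[OF G]]) simp
  have 8: "time (refine_level_t (s - 1) ?R G) \<le> N ^ 12" if "s > 1"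
  proof -
    have "refining invariant (N ^ 11) (refine_level_t (s - 1) ?R)"
      using that below_le(1) smallD(1)[OF R] pr_forced by (intro refining_refine_level) auto
    from power_up[OF refiningD(1)[OF this G]] show ?thesis by simp
  qed
  show ?thesis
    using 1 2[of s] 2[of "s - 1"] 3 4 5 6 7[of "replace C (pieces s C G) (G ! s)"] 8 nine_power[of 12]
      s length_state[OF G]
    by (auto simp: step1_cell_def cells_below_def pieces_def pr_t_def inter_pr_vimage_t_def time_if
        simp del: power_Suc)
qed

text \<open>A trivial update leaves \<open>C\<close> as the only piece of itself, so that its projection is
  contained in, and hence equal to, a single cell.  If the projection is not a union of cells, the
  level below is properly refined and the update is not trivial.\<close>

lemma step1_cell_Some:
  assumes "result (step1_cell s C G) = Some G'"
  shows "invariant G'" "grows G G'" "set (G ! s) - {C} \<subseteq> set (G' ! s)"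
    "G' = G \<Longrightarrow> butlast ` set C \<in> set ` set (G ! (s - 1))"
proof -
  have part: "list_partition (tuples Q (s + 2)) (G ! s)"
    by (rule level_partition[OF G s(2)])
  have len: "s < length G" "s - 1 < length G"
    using s length_state[OF G] by simp_all
  have "invariant G' \<and> grows G G' \<and> set (G ! s) - {C} \<subseteq> set (G' ! s) \<and>
      (G' = G \<longrightarrow> butlast ` set C \<in> set ` set (G ! (s - 1)))"
  proof (cases "covered s C G")
    case True
    let ?P = "replace C (pieces s C G) (G ! s)"
    note ms = mset_pieces[OF True]
    have G': "G' = G[s := ?P]"
      using assms True by (simp add: result_step1_cell)
    have "forced s (set D)" if "D \<in> set ?P" for D
    proof (cases "D \<in> set (pieces s C G)")
      case True
      then obtain B where B: "B \<in> set (G ! (s - 1))" "set D = {u \<in> set C. butlast u \<in> set B}"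
        by (auto simp: pieces_def cells_below_def)
      show ?thesis
        unfolding B(2)
        by (intro forced_pr_vimage s cell_forced[OF G] below_le(1) C B(1))
    next
      case False
      then show ?thesis
        using set_replaceD[OF part C ms that] cell_forced[OF G s(2)] by blast
    qed
    then have "invariant G'"
      unfolding G' by (intro invariant_update[OF G s] list_partition_replace[OF part C ms])
    moreover have "?P = G ! s \<or> length (G ! s) < length ?P"
      by (rule replace_eq_or_longer[OF part C ms]) (auto simp: pieces_def)
    then have "grows G G'"
      unfolding G' by (rule grows_update) (fact len)
    moreover have "set (G ! s) - {C} \<subseteq> set (G' ! s)"
      using other_cells_survive_replace[OF part C ms] len by (simp add: G')
    moreover have "butlast ` set C \<in> set ` set (G ! (s - 1))" if "G' = G"
    proof -
      have "?P = G ! s"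
        using that len by (metis G' nth_list_update_eq)
      then have "C \<in> set (pieces s C G)"
        using set_replaceD[OF part C ms, of C] C by simp
      then obtain B where B: "B \<in> set (cells_below s C G)" "C = filter (\<lambda>u. butlast u \<in> set B) C"
        by (auto simp: pieces_def)
      then have "butlast ` set C = set B"
        by (auto simp: cells_below_def filter_id_conv dest!: sym[of C])
      with B(1) show ?thesis by (auto simp: cells_below_def)
    qed
    ultimately show ?thesis by blast
  next
    case False
    then have s1: "s > 1" and G': "G' = G[s - 1 := refine (butlast ` set C) (G ! (s - 1))]"
      using assms by (auto simp: result_step1_cell split: if_splits)
    have ref: "result (refine_level_t (s - 1) (map butlast C) G) = G'"
      using result_refine_level_t[OF length_state[OF G] below_le(1)] by (simp add: G')
    have "length (map butlast C) \<le> N"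
      using cell_small[OF G s(2) C] by (simp add: small_def)
    then have "refining invariant (N ^ 11) (refine_level_t (s - 1) (map butlast C))"
      using s1 below_le(1) pr_forced by (intro refining_refine_level) auto
    note refiningD(2,3)[OF this G, unfolded ref]
    moreover have "set (G ! s) - {C} \<subseteq> set (G' ! s)"
      using s1 by (auto simp: G')
    moreover have "covered s C G" if "G' = G"
      unfolding covered_def
    proof
      fix v assume v: "v \<in> butlast ` set C"
      then obtain B where B: "B \<in> set (G ! (s - 1))" "v \<in> set B"
        using list_partition_covers[OF level_partition[OF G below_le(1)]] pr_subset by blast
      then have "set B \<subseteq> butlast ` set C"
        using refine_level_fixed[OF G below_le(1), of "map butlast C" B] ref that v by auto
      with B show "\<exists>B\<in>set (cells_below s C G). v \<in> set B"
        by (auto simp: cells_below_def)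
    qed
    ultimately show ?thesis using False by blast
  qed
  then show "invariant G'" "grows G G'" "set (G ! s) - {C} \<subseteq> set (G' ! s)"
    "G' = G \<Longrightarrow> butlast ` set C \<in> set ` set (G ! (s - 1))"
    by simp_all
qed

text \<open>At level 1 the projection is forced and the cells below are those of every extension;
  so it can fail to be a union of them only if there is no extension.\<close>

lemma step1_cell_None:
  assumes "result (step1_cell s C G) = None"
  shows "\<forall>H. \<not> extends H"
proof (intro allI notI)
  fix H assume H: "extends H"
  have s1: "s = 1" and "\<not> covered s C G"
    using assms s by (auto simp: result_step1_cell split: if_splits)
  moreover have "covered s C G"
    unfolding covered_def
  proof
    fix v assume v: "v \<in> butlast ` set C"
    then obtain B where B: "B \<in> set (G ! (s - 1))" "v \<in> set B"
      using list_partition_covers[OF level_partition[OF G below_le(1)]] pr_subset by blast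
    have "G ! 0 = P0" using G by (simp add: invariant_def)
    then have "set B \<in> H 0"
      using B H set_P0 s1 by (auto simp: extends_def)
    then have "set B \<subseteq> butlast ` set C"
      using forcedD[OF pr_forced H _ B(2) v] s1 by simp
    with B show "\<exists>B\<in>set (cells_below s C G). v \<in> set B"
      by (auto simp: cells_below_def)
  qed
  ultimately show False by blast
qed

end

text \<open>Treating a cell removes only this cell from its level, so the remaining cells of the
  list fixed at the beginning are still there when it is their turn.\<close>

lemma step1_level:
  assumes G: "invariant G" and s: "1 \<le> s" "s \<le> t"
  shows "time (fold_option_t (step1_cell s) (G ! s) G) \<le> N ^ 15 \<and>
    (case result (fold_option_t (step1_cell s) (G ! s) G) of None \<Rightarrow> (\<forall>H. \<not> extends H)
     | Some G' \<Rightarrow> invariant G' \<and> grows G G' \<and>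
         (G' = G \<longrightarrow> (\<forall>C\<in>set (G ! s). butlast ` set C \<in> set ` set (G ! (s - 1)))))"
proof -
  define J where "J Cs G \<longleftrightarrow> invariant G \<and> distinct Cs \<and> set Cs \<subseteq> set (G ! s)" for Cs and G :: state
  have step: "time (step1_cell s C G) \<le> N ^ 13 \<and>
      (case result (step1_cell s C G) of None \<Rightarrow> (\<forall>H. \<not> extends H)
       | Some G' \<Rightarrow> J Cs G' \<and> grows G G' \<and>
           (G' = G \<longrightarrow> butlast ` set C \<in> set ` set (G ! (s - 1))))"
    if "J (C # Cs) G" for C Cs G
  proof -
    have *: "invariant G" "C \<in> set (G ! s)" "set Cs \<subseteq> set (G ! s) - {C}" "distinct Cs"
      using that by (auto simp: J_def)
    show ?thesis
    proof (cases "result (step1_cell s C G)")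
      case None
      then show ?thesis
        using step1_cell_cost[OF *(1) s *(2)] step1_cell_None[OF *(1) s *(2)] by simp
    next
      case (Some G')
      note spec = step1_cell_Some[OF *(1) s *(2) Some]
      have "J Cs G'"
        using spec(1) subset_trans[OF *(3) spec(3)] *(4) by (simp add: J_def)
      then show ?thesis
        using step1_cell_cost[OF *(1) s *(2)] spec(2,4) Some by simp
    qed
  qed
  have "J (G ! s) G"
    using G list_partition_distinct[OF level_partition[OF G s(2)]] by (simp add: J_def)
  note fold_option_t_invariant[where J = J and f = "step1_cell s", OF step this]
  then show ?thesis
    using loop_cost[where j = 13, of _ "length (G ! s)" "N ^ 13"] level_length[OF G s(2)]
    by (auto simp: J_def split: option.splits)
qed

lemma step1_spec:
  assumes G: "invariant G"
  shows "time (step1 t G) \<le> N ^ 19 \<and>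
    (case result (step1 t G) of None \<Rightarrow> (\<forall>H. \<not> extends H)
     | Some G' \<Rightarrow> invariant G' \<and> grows G G' \<and>
         (G' = G \<longrightarrow> (\<forall>s\<in>{1..t}. \<forall>C\<in>set (G ! s). butlast ` set C \<in> set ` set (G ! (s - 1)))))"
proof -
  let ?f = "\<lambda>s G. bind_timed (nth_t G s) (\<lambda>P. fold_option_t (step1_cell s) P G)"
  define J where "J ss G \<longleftrightarrow> invariant G \<and> set ss \<subseteq> {1..t}" for ss and G :: state
  have step: "time (?f s G) \<le> N ^ 16 \<and>
      (case result (?f s G) of None \<Rightarrow> (\<forall>H. \<not> extends H)
       | Some G' \<Rightarrow> J ss G' \<and> grows G G' \<and>
           (G' = G \<longrightarrow> (\<forall>C\<in>set (G ! s). butlast ` set C \<in> set ` set (G ! (s - 1)))))"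
    if "J (s # ss) G" for s ss G
  proof -
    have *: "invariant G" "1 \<le> s" "s \<le> t" "s < length G"
      using that length_state[of G] by (auto simp: J_def)
    have "time (nth_t G s) \<le> N ^ 15"
      by (rule power_up[OF state_nth_cost[OF *(1)]]) simp
    then show ?thesis
      using step1_level[OF *(1-3)] *(4) that nine_power[of 15]
      by (auto simp: J_def split: option.splits)
  qed
  have "J [1..<1 + t] G" using G by (auto simp: J_def)
  note loop = fold_option_t_invariant[where J = J and f = ?f, OF step this]
  then have "time (fold_option_t ?f [1..<1 + t] G) \<le> N ^ 18"
    using loop_cost[where j = 16, of _ "length [1..<1 + t]" "N ^ 16"] t_le d_add_6_le_N by simp
  moreover have "time (count_from t 1) \<le> N ^ 18"
    using t_le d_add_6_le_N by (intro power_up[OF count_cost]) simp_all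
  ultimately have "time (step1 t G) \<le> N ^ 19"
    unfolding step1_def result_bind time_bind result_count_from using nine_power[of 18] by simp
  moreover have "set [1..<1 + t] = {1..t}" by auto
  moreover have "result (step1 t G) = result (fold_option_t ?f [1..<1 + t] G)"
    unfolding step1_def result_bind result_count_from ..
  ultimately show ?thesis
    using loop
    by (simp add: J_def del: upt_Suc set_upt split: option.splits)
qed

section \<open>Splitting by rearrangements (step 2)\<close>

text \<open>The bodies of the nested loops get names because the lemmas on loops are applied to
  each of them.\<close>

definition permute_body :: "nat \<Rightarrow> cell \<Rightarrow> nat list \<Rightarrow> state \<Rightarrow> state timed" where
  "permute_body s C \<tau> G = bind_timed (map_t (permute_t \<tau>) C) (\<lambda>S. refine_level_t s S G)"

definition symm :: "nat \<Rightarrow> nat list list" where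
  "symm s = result (permutations_t [0..<0 + (s + 2)])"

definition step2_level :: "nat \<Rightarrow> state \<Rightarrow> state timed" where
  "step2_level s G = bind_timed (nth_t G s) (\<lambda>P.
     bind_timed (count_from (s + 2) 0) (\<lambda>positions.
     bind_timed (permutations_t positions) (\<lambda>symm.
     fold_t (\<lambda>C. fold_t (permute_body s C) symm) P G)))"

lemma step2_eq: "step2 t G = bind_timed (count_from t 1) (\<lambda>levels. fold_t step2_level levels G)"
  unfolding step2_def step2_level_def permute_body_def ..

lemma set_symm:
  "set (symm s) = {map p [0..<s + 2] | p. p permutes {..<s + 2}}"
proof -
  have "(\<exists>p. p permutes {..<s + 2} \<and> \<tau> = map p [0..<s + 2]) \<longleftrightarrow> mset \<tau> = mset [0..<s + 2]" for \<tau>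
  proof
    assume "\<exists>p. p permutes {..<s + 2} \<and> \<tau> = map p [0..<s + 2]"
    then obtain p where p: "p permutes {..<s + 2}" "\<tau> = map p [0..<s + 2]" by blast
    then have "\<tau> = permute_list p [0..<s + 2]"
      by (simp only: permute_list_upt)
    then show "mset \<tau> = mset [0..<s + 2]" using p(1) by simp
  next
    assume "mset \<tau> = mset [0..<s + 2]"
    then obtain p where p: "p permutes {..<s + 2}" "permute_list p [0..<s + 2] = \<tau>"
      using mset_eq_permutation[of \<tau> "[0..<s + 2]"] by auto
    moreover have "permute_list p [0..<s + 2] = map p [0..<s + 2]"
      by (rule permute_list_upt[OF p(1)])
    ultimately show "\<exists>p. p permutes {..<s + 2} \<and> \<tau> = map p [0..<s + 2]" by blast
  qed
  then show ?thesis
    unfolding symm_def set_result_permutations_t by (simp only: add_0) auto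
qed

lemma length_symm: "s \<le> t \<Longrightarrow> length (symm s) \<le> N"
  using fact_le_N[of "s + 2"] by (simp add: symm_def length_result_permutations_t del: upt_Suc fact_Suc)

lemma set_permuted_cell:
  assumes "p permutes {..<s + 2}" "set C \<subseteq> tuples Q (s + 2)"
  shows "set (result (map_t (permute_t (map p [0..<s + 2])) C)) = permute_list p ` set C"
proof -
  have "result (permute_t (map p [0..<s + 2]) u) = permute_list p u" if "u \<in> set C" for u
  proof -
    have "length u = s + 2" using that assms(2) by (auto simp: tuples_def)
    moreover from this have "set (map p [0..<s + 2]) \<subseteq> {..<length u}"
      using permutes_image[OF assms(1)] by (simp add: atLeast0LessThan del: upt_Suc)
    ultimately show ?thesis
      by (simp add: result_permute_t permute_list_def del: upt_Suc)
  qed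
  then show ?thesis by simp
qed

lemma refining_permute_body:
  assumes s: "1 \<le> s" "s \<le> t" and C: "small C" "set C \<subseteq> tuples Q (s + 2)" "forced s (set C)"
    and \<tau>: "\<tau> \<in> set (symm s)"
  shows "refining invariant (N ^ 12) (permute_body s C \<tau>)"
proof -
  obtain p where p: "p permutes {..<s + 2}" "\<tau> = map p [0..<s + 2]"
    using \<tau> by (auto simp: set_symm)
  have "time (permute_t \<tau> u) \<le> N ^ 4" if "u \<in> set C" for u
    using smallD(2)[OF C(1) that] s t_le d_add_6_le_N unfolding permute_t_def
    by (intro map_cost[where j = 2, simplified]) (auto simp: p(2) intro: nth_cost)
  then have "time (map_t (permute_t \<tau>) C) \<le> N ^ 6"
    using smallD(1)[OF C(1)] by (intro map_cost[where j = 4, simplified])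
  then have "time (map_t (permute_t \<tau>) C) \<le> N ^ 11" by (rule power_up) simp
  moreover have "refining invariant (N ^ 11) (refine_level_t s (result (map_t (permute_t \<tau>) C)))"
    using smallD(1)[OF C(1)] forced_permute[OF s(2) C(2,3) p(1)]
    by (intro refining_refine_level s) (simp, simp only: p(2) set_permuted_cell[OF p(1) C(2)])
  ultimately have "refining invariant (N ^ 11 + N ^ 11) (permute_body s C \<tau>)"
    unfolding permute_body_def[abs_def] by (rule refining_bind_const)
  then show ?thesis
    by (rule refining_mono) (use power_add_up[of "N ^ 11" 11] in simp)
qed

lemma result_step2_level:
  "s < length G \<Longrightarrow> result (step2_level s G) =
     result (fold_t (\<lambda>C. fold_t (permute_body s C) (symm s)) (G ! s) G)"
  unfolding step2_level_def result_bind result_count_from symm_def by (simp only: result_nth_t)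

context
  fixes G s assumes G: "invariant G" and s: "1 \<le> s" "s \<le> t"
begin

lemma refining_permute_cell:
  "C \<in> set (G ! s) \<Longrightarrow> refining invariant (N ^ 14) (fold_t (permute_body s C) (symm s))"
  using cell_small[OF G s(2)] cell_subset[OF G s(2)] cell_forced[OF G s(2)]
  by (intro refining_loop[where j = 12, simplified] length_symm refining_permute_body s) simp_all

lemma step2_level_spec:
  "time (step2_level s G) \<le> N ^ 17 \<and> invariant (result (step2_level s G)) \<and>
    grows G (result (step2_level s G))"
proof -
  have len: "s < length G" using length_state[OF G] s by simp
  have "refining invariant (N ^ 16) (fold_t (\<lambda>C. fold_t (permute_body s C) (symm s)) (G ! s))"
    by (intro refining_loop[where j = 14, simplified] refining_permute_cell level_length[OF G s(2)])
  note loop = refiningD[OF this G]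
  have "time (nth_t G s) \<le> N ^ 16"
    by (rule power_up[OF state_nth_cost[OF G]]) simp
  moreover have "time (count_from (s + 2) 0) \<le> N ^ 16"
    by (rule power_up[OF count_cost]) (use s t_le d_add_6_le_N in simp_all)
  moreover have "time (permutations_t [0..<0 + (s + 2)]) \<le> N ^ 16"
    by (rule power_up[OF permutations_cost])
      (use s t_le d_add_6_le_N fact_le_N[of "s + 2"] in \<open>simp_all del: upt_Suc fact_Suc\<close>)
  ultimately have "time (step2_level s G) \<le> N ^ 17"
    unfolding step2_level_def time_bind result_bind result_count_from result_nth_t[OF len]
    using loop(1) nine_power[of 16] unfolding symm_def by simp
  then show ?thesis
    using loop(2,3) by (simp only: result_step2_level[OF len])
qed

text \<open>A trivial update tells only that the rearranged cell is a union of cells.  Applying this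
  to the inverse rearrangement of one of these cells shows that there is just one.\<close>

lemma step2_level_fixed:
  assumes fixed: "result (step2_level s G) = G" and C: "C \<in> set (G ! s)" and p: "p permutes {..<s + 2}"
  shows "permute_list p ` set C \<in> set ` set (G ! s)"
proof -
  have len: "s < length G" using length_state[OF G] s by simp
  have *: "result (permute_body s C (map p [0..<s + 2]) G) = G"
    if "C \<in> set (G ! s)" "p permutes {..<s + 2}" for C p
  proof -
    have "result (fold_t (permute_body s C) (symm s) G) = G"
      using fold_t_fixed[OF refining_permute_cell G _ that(1)] fixed
      by (simp only: result_step2_level[OF len])
    moreover have "map p [0..<s + 2] \<in> set (symm s)"
      using that(2) by (auto simp: set_symm)
    ultimately show ?thesis
      using cell_small[OF G s(2) that(1)] cell_subset[OF G s(2) that(1)] cell_forced[OF G s(2) that(1)]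
      by (intro fold_t_fixed[OF refining_permute_body[OF s] G]) 
  qed
  have closed: "set D \<subseteq> permute_list p ` set C"
    if "C \<in> set (G ! s)" "p permutes {..<s + 2}" "D \<in> set (G ! s)" "u \<in> set D" "u \<in> permute_list p ` set C"
    for C D p u
  proof -
    let ?S = "result (map_t (permute_t (map p [0..<s + 2])) C)"
    have S: "set ?S = permute_list p ` set C"
      by (rule set_permuted_cell[OF that(2) cell_subset[OF G s(2) that(1)]])
    have "result (refine_level_t s ?S G) = G"
      using *[OF that(1,2)] by (simp only: permute_body_def result_bind)
    from refine_level_fixed[OF G s(2) this that(3)] show ?thesis
      using that(4,5) unfolding S by blast
  qed
  obtain u where u: "u \<in> set C"
    using list_partition_nonempty[OF level_partition[OF G s(2)] C] by (cases C) auto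
  have "permute_list p u \<in> tuples Q (s + 2)"
    using permute_list_in_tuples[OF p] cell_subset[OF G s(2) C] u by auto
  then obtain D where D: "D \<in> set (G ! s)" "permute_list p u \<in> set D"
    using list_partition_covers[OF level_partition[OF G s(2)]] by blast
  have "set D \<subseteq> permute_list p ` set C"
    using closed[OF C p D] u by blast
  moreover have "permute_list p ` set C \<subseteq> set D"
  proof -
    have inv: "permute_list (inv p) (permute_list p v) = v" if "v \<in> tuples Q (s + 2)" for v
      by (rule permute_list_inverse[OF p]) (use that in \<open>simp add: tuples_def\<close>)
    have inv': "permute_list p (permute_list (inv p) v) = v" if "v \<in> tuples Q (s + 2)" for v
    proof -
      have "permute_list (inv (inv p)) (permute_list (inv p) v) = v"
        by (rule permute_list_inverse[OF permutes_inv[OF p]]) (use that in \<open>simp add: tuples_def\<close>)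
      then show ?thesis by (simp only: permutes_inv_inv[OF p])
    qed
    \<comment> \<open>The cell \<open>D\<close> contains a rearranged tuple of \<open>C\<close>, so the inverse rearrangement of \<open>D\<close> meets \<open>C\<close>.\<close>
    have "u = permute_list (inv p) (permute_list p u)"
      using inv u cell_subset[OF G s(2) C] by force
    then have "set C \<subseteq> permute_list (inv p) ` set D"
      using closed[OF D(1) permutes_inv[OF p] C u] D(2) by blast
    then show ?thesis
      using inv' cell_subset[OF G s(2) D(1)] by force
  qed
  ultimately show ?thesis using D(1) by blast
qed

end

lemma refining_step2_level: "1 \<le> s \<Longrightarrow> s \<le> t \<Longrightarrow> refining invariant (N ^ 17) (step2_level s)"
  using step2_level_spec by (simp add: refining_def)

lemma refining_step2: "refining invariant (N ^ 20) (step2 t)"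
proof -
  have "refining invariant (N ^ 19) (fold_t step2_level [1..<1 + t])"
    using t_le d_add_6_le_N by (intro refining_loop[where j = 17, simplified] refining_step2_level) auto
  moreover have "time (count_from t 1) \<le> N ^ 19"
    by (rule power_up[OF count_cost]) (use t_le d_add_6_le_N in simp_all)
  ultimately have "refining invariant (N ^ 19 + N ^ 19)
      (\<lambda>G. bind_timed (count_from t 1) (\<lambda>levels. fold_t step2_level levels G))"
    by (intro refining_bind_const) (simp_all only: result_count_from)
  then have "refining invariant (N ^ 19 + N ^ 19) (step2 t)"
    by (simp only: step2_eq[abs_def])
  then show ?thesis
    by (rule refining_mono) (use power_add_up[of "N ^ 19" 19] in simp)
qed

lemma step2_fixed:
  assumes G: "invariant G" "result (step2 t G) = G" and s: "1 \<le> s" "s \<le> t"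
    and C: "C \<in> set (G ! s)" and p: "p permutes {..<s + 2}"
  shows "permute_list p ` set C \<in> set ` set (G ! s)"
proof -
  have "result (fold_t step2_level [1..<1 + t] G) = G"
    using G(2) by (simp only: step2_eq result_bind result_count_from)
  then have "result (step2_level s G) = G"
    by (rule fold_t_fixed[where xs = "[1..<1 + t]", OF refining_step2_level G(1), rotated 2])
      (use s in auto)
  from step2_level_fixed[OF G(1) s this C p] show ?thesis .
qed

section \<open>Splitting by products of adjacency tensors (step 3)\<close>

definition entry_list :: "nat \<Rightarrow> nat \<Rightarrow> cell \<Rightarrow> cell \<Rightarrow> (tuple \<times> int) list timed" where
  "entry_list s m A B = bind_timed (tuples_t [1..<1 + d] (s + 2)) (\<lambda>us. map_t (\<lambda>u.
     bind_timed (inner_product_entry_t [1..<1 + d] (m + 1) (adjacency_t A) (adjacency_t B) u)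
       (\<lambda>p. return (u, p))) us)"

definition level_set :: "(tuple \<times> int) list \<Rightarrow> nat \<Rightarrow> cell timed" where
  "level_set P r = bind_timed (filter_t (\<lambda>(u, p). return (p = int r)) P) (map_t (\<lambda>(u, p). return u))"

definition step3_body :: "nat \<Rightarrow> (tuple \<times> int) list \<Rightarrow> nat \<Rightarrow> state \<Rightarrow> state timed" where
  "step3_body s P r G = bind_timed (level_set P r) (\<lambda>S. refine_level_t s S G)"

text \<open>The list of points and the list of entries do not depend on the state, so they can be
  regarded as computed in advance of the loop over the values.\<close>

lemma step3_pair_eq:
  "step3_pair d s m A B G = bind_timed (count_from d 1) (\<lambda>_. bind_timed (entry_list s m A B) (\<lambda>P.
     bind_timed (count_from (d + 1) 0) (\<lambda>rs. fold_t (step3_body s P) rs G)))"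
  unfolding step3_pair_def entry_list_def step3_body_def level_set_def bind_timed_assoc
  by (simp only: bind_timed_def result_count_from timed.sel)

text \<open>The entries of adjacency tensors are 0 or 1, so that the sum of products counts the
  points at which both are 1.\<close>

lemma result_inner_product_entry:
  "result (inner_product_entry_t [1..<1 + d] k (adjacency_t A) (adjacency_t B) u) =
    int (inner_entry Q k (set A) (set B) u)"
proof -
  have fold: "fold (\<lambda>j a. a + (if take k u @ [j] \<in> set A then 1 else 0) *
        (if j # drop k u \<in> set B then 1 else 0)) qs a
      = a + int (card {z \<in> set qs. take k u @ [z] \<in> set A \<and> z # drop k u \<in> set B})"
    if "distinct qs" for qs :: "nat list" and a
    using that
  proof (induction qs arbitrary: a)
    case (Cons q qs)
    let ?ok = "\<lambda>z. take k u @ [z] \<in> set A \<and> z # drop k u \<in> set B"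
    have "{z \<in> set (q # qs). ?ok z} = (if ?ok q then insert q {z \<in> set qs. ?ok z} else {z \<in> set qs. ?ok z})"
      by auto
    with Cons show ?case by auto
  qed simp
  have "set [1..<1 + d] = Q" by auto
  then show ?thesis
    using fold[of "[1..<1 + d]" 0]
    by (simp add: inner_product_entry_t_def adjacency_t_def inner_entry_def if_distrib[of result]
        del: upt_Suc set_upt cong: if_cong)
qed

lemma set_tuples_list: "set (result (tuples_t [1..<1 + d] n)) = tuples Q n"
proof -
  have "set [1..<1 + d] = Q" by auto
  then show ?thesis by (simp only: set_result_tuples_t)
qed

lemma result_entry_list:
  "result (entry_list s m A B) = map (\<lambda>u. (u, int (inner_entry Q (m + 1) (set A) (set B) u)))
     (result (tuples_t [1..<1 + d] (s + 2)))"
  unfolding entry_list_def result_bind result_map_t result_return result_inner_product_entry ..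

lemma set_level_set:
  "set (result (level_set (result (entry_list s m A B)) r)) =
     {w \<in> tuples Q (s + 2). inner_entry Q (m + 1) (set A) (set B) w = r}"
proof -
  have "result (level_set P r) = map fst (filter (\<lambda>(u, p). p = int r) P)" for P
    by (simp add: level_set_def split_def)
  then show ?thesis
    unfolding result_entry_list
    using set_tuples_list[of "s + 2"] by (auto simp: image_iff simp del: upt_Suc tuples_t.simps)
qed

context
  fixes s m A B
  assumes s: "1 \<le> s" "s \<le> t" and m: "m \<le> s"
    and A: "small A" "set A \<subseteq> tuples Q (m + 2)" "forced m (set A)"
    and B: "small B" "set B \<subseteq> tuples Q (s - m + 2)" "forced (s - m) (set B)"
begin

lemma length_tuples_list: "length (result (tuples_t [1..<1 + d] (s + 2))) \<le> N"
  using power_d_le_N[of "s + 2"] s by (simp only: length_result_tuples_t) simp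

lemma entry_list_cost: "time (entry_list s m A B) \<le> N ^ 11"
proof -
  have qs: "length [1..<1 + d] \<le> N" using d_add_6_le_N by simp
  have "time (tuples_t [1..<1 + d] (s + 2)) \<le> N ^ 7"
    using power_d_le_N[of "s + 2"] s d_add_6_le_N t_le by (intro tuples_cost) simp_all
  then have 1: "time (tuples_t [1..<1 + d] (s + 2)) \<le> N ^ 10" by (rule power_up) simp
  have entry: "time (inner_product_entry_t [1..<1 + d] (m + 1) (adjacency_t A) (adjacency_t B) u) \<le> N ^ 8"
    if "u \<in> tuples Q (s + 2)" for u
  proof -
    have u: "length u = s + 2" using that by (simp add: tuples_def)
    have "time (adjacency_t C v) \<le> N ^ 4" if "small C" "length v \<le> N" for C v
      using member_cost[OF that(2) smallD(1)[OF that(1)]] by (simp add: adjacency_t_def)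
    note adj = this
    have body: "time (bind_timed (append_t (take (m + 1) u) [j]) (\<lambda>xj. bind_timed (adjacency_t A xj)
        (\<lambda>e. bind_timed (adjacency_t B (j # drop (m + 1) u)) (\<lambda>f. return (a + e * f))))) \<le> N ^ 5"
      for j a
    proof -
      have "time (append_t (take (m + 1) u) [j]) \<le> N ^ 4"
        by (rule power_up[OF append_cost]) (use u s t_le d_add_6_le_N in simp_all)
      moreover have "time (adjacency_t A (take (m + 1) u @ [j])) \<le> N ^ 4"
        by (rule adj[OF A(1)]) (use u s t_le d_add_6_le_N in simp)
      moreover have "time (adjacency_t B (j # drop (m + 1) u)) \<le> N ^ 4"
        by (rule adj[OF B(1)]) (use u s t_le d_add_6_le_N in simp)
      ultimately show ?thesis using nine_power[of 4] by simp
    qed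
    have "time (fold_t (\<lambda>j a. bind_timed (append_t (take (m + 1) u) [j]) (\<lambda>xj. bind_timed (adjacency_t A xj)
        (\<lambda>e. bind_timed (adjacency_t B (j # drop (m + 1) u)) (\<lambda>f. return (a + e * f)))))
        [1..<1 + d] 0) \<le> length [1..<1 + d] * (N ^ 5 + 1) + 1"
      by (rule time_fold_t[where I = "\<lambda>_. True"]) (simp_all only: body simp_thms)
    from loop_cost[OF this qs order_refl] have "time (fold_t (\<lambda>j a. bind_timed (append_t (take (m + 1) u) [j])
        (\<lambda>xj. bind_timed (adjacency_t A xj)
        (\<lambda>e. bind_timed (adjacency_t B (j # drop (m + 1) u)) (\<lambda>f. return (a + e * f)))))
        [1..<1 + d] 0) \<le> N ^ 7"
      by (simp only: numeral_plus_numeral add_num_simps)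
    moreover have "time (take_t (m + 1) u) \<le> N ^ 7" "time (drop_t (m + 1) u) \<le> N ^ 7"
      using power_up[OF take_cost, of u 7] power_up[OF drop_cost, of u 7] u s t_le d_add_6_le_N
      by simp_all
    ultimately show ?thesis
      unfolding inner_product_entry_t_def time_bind result_take_t result_drop_t
      using nine_power[of 7] by simp
  qed
  have "time (map_t (\<lambda>u.
     bind_timed (inner_product_entry_t [1..<1 + d] (m + 1) (adjacency_t A) (adjacency_t B) u)
       (\<lambda>p. return (u, p))) (result (tuples_t [1..<1 + d] (s + 2)))) \<le> N ^ (8 + 2)"
    by (rule map_cost[OF _ length_tuples_list])
      (simp only: set_tuples_list time_bind time_return add_0_right entry)
  then show ?thesis
    unfolding entry_list_def time_bind using 1 nine_power[of 10] by simp
qed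

lemma refining_step3_body:
  "refining invariant (N ^ 12) (step3_body s (result (entry_list s m A B)) r)"
proof -
  let ?P = "result (entry_list s m A B)"
  have P: "length ?P \<le> N"
    using length_tuples_list by (simp only: result_entry_list length_map)
  have "time (filter_t (\<lambda>(u, p). return (p = int r)) ?P) \<le> N ^ 2"
    by (rule filter_cost[where j = 0, unfolded add_0, OF _ P]) (simp add: case_prod_beta)
  moreover have filter: "length (filter (\<lambda>(u, p). p = int r) ?P) \<le> N"
    by (rule le_trans[OF length_filter_le P])
  have "time (map_t (\<lambda>(u, p). return u) (filter (\<lambda>(u, p). p = int r) ?P)) \<le> N ^ 2"
    by (rule map_cost[where j = 0, unfolded add_0, OF _ filter]) (simp add: case_prod_beta)
  ultimately have "time (level_set ?P r) \<le> N ^ 3"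
    using nine_power[of 2] by (simp add: level_set_def split_def)
  then have "time (level_set ?P r) \<le> N ^ 11" by (rule power_up) simp
  moreover have "length (result (level_set ?P r)) \<le> N"
    using filter by (simp add: level_set_def split_def)
  then have "refining invariant (N ^ 11) (refine_level_t s (result (level_set ?P r)))"
    by (intro refining_refine_level s)
      (simp_all only: set_level_set forced_inner_entry[OF s(2) m A(3,2) B(3,2)])
  ultimately have "refining invariant (N ^ 11 + N ^ 11) (step3_body s ?P r)"
    unfolding step3_body_def[abs_def] by (rule refining_bind_const)
  then show ?thesis
    by (rule refining_mono) (use power_add_up[of "N ^ 11" 11] in simp)
qed

lemma result_step3_pair: "result (step3_pair d s m A B G) =
    result (fold_t (step3_body s (result (entry_list s m A B))) [0..<0 + (d + 1)] G)"
  unfolding step3_pair_eq result_bind result_count_from ..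

lemma refining_step3_pair: "refining invariant (N ^ 15) (step3_pair d s m A B)"
proof -
  let ?P = "result (entry_list s m A B)"
  have "refining invariant (N ^ 14) (fold_t (step3_body s ?P) [0..<0 + (d + 1)])"
    using d_add_6_le_N by (intro refining_loop[where j = 12, simplified] refining_step3_body) simp
  note loop = refiningD[OF this]
  have "time (step3_pair d s m A B G) \<le> N ^ 15" if "invariant G" for G
  proof -
    have "time (count_from d 1) \<le> N ^ 14" "time (count_from (d + 1) 0) \<le> N ^ 14"
      using power_up[OF count_cost, of d 14 1] power_up[OF count_cost, of "d + 1" 14 0] d_add_6_le_N
      by simp_all
    moreover have "time (entry_list s m A B) \<le> N ^ 14"
      by (rule power_up[OF entry_list_cost]) simp
    ultimately show ?thesis
      using loop(1)[OF that] nine_power[of 14]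
      unfolding step3_pair_eq time_bind result_bind result_count_from by simp
  qed
  then show ?thesis
    using loop(2,3) unfolding refining_def result_step3_pair by blast
qed

text \<open>The entries are at most \<open>d\<close>, so the level set through a tuple of \<open>C\<close> is among those
  along which \<open>C\<close> is cut; a trivial cut leaves \<open>C\<close> inside it.\<close>

lemma step3_pair_fixed:
  assumes G: "invariant G" "result (step3_pair d s m A B G) = G" and C: "C \<in> set (G ! s)"
  shows "\<exists>c. \<forall>w\<in>set C. inner_entry Q (m + 1) (set A) (set B) w = c"
proof -
  let ?e = "inner_entry Q (m + 1) (set A) (set B)"
  obtain w where w: "w \<in> set C"
    using list_partition_nonempty[OF level_partition[OF G(1) s(2)] C] by (cases C) auto
  have "?e w \<le> card Q"
    unfolding inner_entry_def by (rule card_mono) auto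
  then have "?e w \<le> d" by simp
  then have "?e w \<in> set [0..<0 + (d + 1)]"
    unfolding set_upt atLeastLessThan_iff by linarith
  then have "result (step3_body s (result (entry_list s m A B)) (?e w) G) = G"
    using G(2) unfolding result_step3_pair
    by (intro fold_t_fixed[OF refining_step3_body G(1)])
  then have "result (refine_level_t s (result (level_set (result (entry_list s m A B)) (?e w))) G) = G"
    by (simp only: step3_body_def result_bind)
  from refine_level_fixed[OF G(1) s(2) this C]
  have "set C \<subseteq> {v \<in> tuples Q (s + 2). ?e v = ?e w}"
    using w cell_subset[OF G(1) s(2) C] unfolding set_level_set by blast
  then show ?thesis by blast
qed

end

definition step3_round :: "nat \<Rightarrow> nat \<Rightarrow> state \<Rightarrow> state timed" where
  "step3_round s m G = bind_timed (nth_t G m) (\<lambda>As. bind_timed (nth_t G (s - m)) (\<lambda>Bs.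
     fold_t (\<lambda>A. fold_t (\<lambda>B. step3_pair d s m A B) Bs) As G))"

definition step3_level :: "nat \<Rightarrow> state \<Rightarrow> state timed" where
  "step3_level s G = bind_timed (count_from (s + 1) 0) (\<lambda>ms. fold_t (step3_round s) ms G)"

lemma step3_eq: "step3 d t G = bind_timed (count_from t 1) (\<lambda>levels. fold_t step3_level levels G)"
  unfolding step3_def step3_level_def step3_round_def ..

context
  fixes G s m assumes G: "invariant G" and s: "1 \<le> s" "s \<le> t" and m: "m \<le> s"
begin

lemma complement_le: "m \<le> t" "s - m \<le> t" and complement_less: "m < length G" "s - m < length G"
  using s m length_state[OF G] by auto

lemma refining_pair:
  assumes "A \<in> set (G ! m)" "B \<in> set (G ! (s - m))"
  shows "refining invariant (N ^ 15) (step3_pair d s m A B)"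
  by (rule refining_step3_pair[OF s m
        cell_small[OF G complement_le(1) assms(1)] cell_subset[OF G complement_le(1) assms(1)]
        cell_forced[OF G complement_le(1) assms(1)]
        cell_small[OF G complement_le(2) assms(2)] cell_subset[OF G complement_le(2) assms(2)]
        cell_forced[OF G complement_le(2) assms(2)]])

lemma refining_pairs:
  "A \<in> set (G ! m) \<Longrightarrow> refining invariant (N ^ 17) (fold_t (\<lambda>B. step3_pair d s m A B) (G ! (s - m)))"
  by (intro refining_loop[where j = 15, simplified] refining_pair level_length[OF G] complement_le)

lemma result_step3_round: "result (step3_round s m G) =
    result (fold_t (\<lambda>A. fold_t (\<lambda>B. step3_pair d s m A B) (G ! (s - m))) (G ! m) G)"
  unfolding step3_round_def result_bind by (simp only: result_nth_t complement_less)

lemma step3_round_spec: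
  "time (step3_round s m G) \<le> N ^ 20 \<and> invariant (result (step3_round s m G)) \<and>
    grows G (result (step3_round s m G))"
proof -
  have "refining invariant (N ^ 19) (fold_t (\<lambda>A. fold_t (\<lambda>B. step3_pair d s m A B) (G ! (s - m))) (G ! m))"
    by (intro refining_loop[where j = 17, simplified] refining_pairs level_length[OF G] complement_le)
  note loop = refiningD[OF this G]
  have "time (nth_t G r) \<le> N ^ 19" for r
    by (rule power_up[OF state_nth_cost[OF G]]) simp
  from this[of m] this[of "s - m"] have "time (step3_round s m G) \<le> N ^ 20"
    unfolding step3_round_def time_bind result_nth_t[OF complement_less(1)]
      result_nth_t[OF complement_less(2)]
    using loop(1) nine_power[of 19] by simp
  with loop(2,3) show ?thesis by (simp only: result_step3_round)
qed

lemma step3_round_fixed: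
  assumes fixed: "result (step3_round s m G) = G"
    and "A \<in> set (G ! m)" "B \<in> set (G ! (s - m))" "C \<in> set (G ! s)"
  shows "\<exists>c. \<forall>w\<in>set C. inner_entry Q (m + 1) (set A) (set B) w = c"
proof -
  have "result (fold_t (\<lambda>B. step3_pair d s m A B) (G ! (s - m)) G) = G"
    using fold_t_fixed[OF refining_pairs G _ assms(2)] fixed by (simp only: result_step3_round)
  from fold_t_fixed[OF refining_pair[OF assms(2)] G this assms(3)]
  have "result (step3_pair d s m A B G) = G" .
  from step3_pair_fixed[OF s m
      cell_small[OF G complement_le(1) assms(2)] cell_subset[OF G complement_le(1) assms(2)]
      cell_forced[OF G complement_le(1) assms(2)]
      cell_small[OF G complement_le(2) assms(3)] cell_subset[OF G complement_le(2) assms(3)]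
      cell_forced[OF G complement_le(2) assms(3)] G this assms(4)]
  show ?thesis .
qed

end

lemma refining_step3_round:
  "1 \<le> s \<Longrightarrow> s \<le> t \<Longrightarrow> m \<le> s \<Longrightarrow> refining invariant (N ^ 20) (step3_round s m)"
  using step3_round_spec by (simp add: refining_def)

lemma refining_step3_level:
  assumes s: "1 \<le> s" "s \<le> t"
  shows "refining invariant (N ^ 23) (step3_level s)"
proof -
  have "refining invariant (N ^ 22) (fold_t (step3_round s) [0..<0 + (s + 1)])"
    using s t_le d_add_6_le_N
    by (intro refining_loop[where j = 20, simplified] refining_step3_round) auto
  moreover have "time (count_from (s + 1) 0) \<le> N ^ 22"
    by (rule power_up[OF count_cost]) (use s t_le d_add_6_le_N in simp_all)
  ultimately have "refining invariant (N ^ 22 + N ^ 22) (step3_level s)"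
    unfolding step3_level_def[abs_def] by (intro refining_bind_const) (simp_all only: result_count_from)
  then show ?thesis
    by (rule refining_mono) (use power_add_up[of "N ^ 22" 22] in simp)
qed

lemma refining_step3: "refining invariant (N ^ 26) (step3 d t)"
proof -
  have "refining invariant (N ^ 25) (fold_t step3_level [1..<1 + t])"
    using t_le d_add_6_le_N by (intro refining_loop[where j = 23, simplified] refining_step3_level) auto
  moreover have "time (count_from t 1) \<le> N ^ 25"
    by (rule power_up[OF count_cost]) (use t_le d_add_6_le_N in simp_all)
  ultimately have "refining invariant (N ^ 25 + N ^ 25)
      (\<lambda>G. bind_timed (count_from t 1) (\<lambda>levels. fold_t step3_level levels G))"
    by (intro refining_bind_const) (simp_all only: result_count_from)
  then have "refining invariant (N ^ 25 + N ^ 25) (step3 d t)"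
    by (simp only: step3_eq[abs_def])
  then show ?thesis
    by (rule refining_mono) (use power_add_up[of "N ^ 25" 25] in simp)
qed

lemma step3_fixed:
  assumes G: "invariant G" "result (step3 d t G) = G" and s: "1 \<le> s" "s \<le> t" and m: "m \<le> s"
    and cells: "A \<in> set (G ! m)" "B \<in> set (G ! (s - m))" "C \<in> set (G ! s)"
  shows "\<exists>c. \<forall>w\<in>set C. inner_entry Q (m + 1) (set A) (set B) w = c"
proof -
  have "result (fold_t step3_level [1..<1 + t] G) = G"
    using G(2) by (simp only: step3_eq result_bind result_count_from)
  then have "result (step3_level s G) = G"
    by (rule fold_t_fixed[where xs = "[1..<1 + t]", OF refining_step3_level G(1), rotated 2])
      (use s in auto)
  then have "result (fold_t (step3_round s) [0..<0 + (s + 1)] G) = G"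
    by (simp only: step3_level_def result_bind result_count_from)
  then have "result (step3_round s m G) = G"
    by (rule fold_t_fixed[where xs = "[0..<0 + (s + 1)]", OF refining_step3_round[OF s] G(1), rotated])
      (use m in auto)
  from step3_round_fixed[OF G(1) s m this cells] show ?thesis .
qed

section \<open>Fixed points and the main loop\<close>

definition partitions_of :: "state \<Rightarrow> nat \<Rightarrow> tuple set set" where
  "partitions_of G s = set ` set (G ! s)"

text \<open>For pairs, the closure of the relations under transposition is all there is to show.\<close>

lemma pair_tuples_permute:
  assumes C: "C \<in> pair_tuples \<Gamma>" and p: "p permutes {..<2::nat}"
  shows "permute_list p ` C \<in> pair_tuples \<Gamma>"
proof -
  obtain R where R: "R \<in> \<Gamma>" "C = {[x, y] | x y. (x, y) \<in> R}"
    using C by (auto simp: pair_tuples_def)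
  have "{..<2::nat} = {0, 1}" by auto
  with p have "p = id \<or> p = Transposition.transpose 0 1"
    by (simp add: permutes_doubleton_iff)
  then show ?thesis
  proof
    assume "p = id"
    with C show ?thesis by simp
  next
    assume p: "p = Transposition.transpose 0 1"
    have "permute_list p [x, y] = [y, x]" for x y :: nat
      by (simp add: permute_list_def p)
    then have R_swap: "permute_list p ` C = {[x, y] | x y. (x, y) \<in> {(y, x) | x y. (x, y) \<in> R}}"
      unfolding R(2) by (auto simp: image_iff) metis
    have "{(y, x) | x y. (x, y) \<in> R} \<in> \<Gamma>"
      using scheme R(1) by (simp add: association_scheme_def)
    then show ?thesis
      unfolding pair_tuples_def R_swap by (rule imageI)
  qed
qed

lemma pair_tuples_regular:
  assumes "A \<in> pair_tuples \<Gamma>" "B \<in> pair_tuples \<Gamma>" "C \<in> pair_tuples \<Gamma>"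
  shows "\<exists>c. \<forall>x y. length x = 1 \<and> length y = 1 \<and> x @ y \<in> C \<longrightarrow>
    card {z \<in> Q. x @ [z] \<in> A \<and> z # y \<in> B} = c"
proof -
  obtain RA RB RC where R: "RA \<in> \<Gamma>" "RB \<in> \<Gamma>" "RC \<in> \<Gamma>"
    "A = {[x, y] | x y. (x, y) \<in> RA}" "B = {[x, y] | x y. (x, y) \<in> RB}" "C = {[x, y] | x y. (x, y) \<in> RC}"
    using assms unfolding pair_tuples_def by (elim imageE)
  have "\<exists>c. \<forall>(x, y)\<in>RC. card {z \<in> Q. (x, z) \<in> RA \<and> (z, y) \<in> RB} = c"
    using scheme R(1-3) unfolding association_scheme_def by simp
  then obtain c where c: "\<forall>(x, y)\<in>RC. card {z \<in> Q. (x, z) \<in> RA \<and> (z, y) \<in> RB} = c"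
    by (elim exE)
  have "card {z \<in> Q. x @ [z] \<in> A \<and> z # y \<in> B} = c"
    if xy: "length x = 1" "length y = 1" "x @ y \<in> C" for x y
  proof -
    obtain a b where ab: "x = [a]" "y = [b]"
      using xy by (metis One_nat_def length_0_conv length_Suc_conv)
    then have "(a, b) \<in> RC" using xy(3) R(6) by simp
    moreover have "{z \<in> Q. x @ [z] \<in> A \<and> z # y \<in> B} = {z \<in> Q. (a, z) \<in> RA \<and> (z, b) \<in> RB}"
      by (simp add: ab R(4,5))
    ultimately show ?thesis using c by auto
  qed
  then show ?thesis by blast
qed

text \<open>The updates concern the levels from 1 on.  At level 0, closure under rearrangement and constancy
  of the products are properties of the association scheme.\<close>

lemma fixed_point_extends:
  assumes G: "invariant G" and steps: "result (step1 t G) = Some G" "result (step2 t G) = G"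
    "result (step3 d t G) = G"
  shows "extends (partitions_of G)"
proof -
  have zero: "partitions_of G 0 = pair_tuples \<Gamma>"
    using G set_P0 by (simp add: partitions_of_def invariant_def)
  have "{[x, x] | x. x \<in> Q} \<in> pair_tuples \<Gamma>"
  proof -
    have "{(x, x) | x. x \<in> Q} \<in> \<Gamma>" using scheme by (simp add: association_scheme_def)
    moreover have "{[x, x] | x. x \<in> Q} = {[x, y] | x y. (x, y) \<in> {(x, x) | x. x \<in> Q}}" by auto
    ultimately show ?thesis unfolding pair_tuples_def by (rule rev_image_eqI)
  qed
  moreover have "partition_on (tuples Q (n + 2)) (partitions_of G n)" if "n \<le> t" for n
    unfolding partitions_of_def by (rule list_partition_partition_on[OF level_partition[OF G that]])
  moreover have "butlast ` C \<in> partitions_of G (n - 1)"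
    if "1 \<le> n" "n \<le> t" "C \<in> partitions_of G n" for n C
    using step1_spec[OF G] that by (auto simp: steps(1) partitions_of_def)
  moreover have "permute_list p ` C \<in> partitions_of G n"
    if "n \<le> t" "C \<in> partitions_of G n" "p permutes {..<n + 2}" for n C p
  proof (cases "n = 0")
    case True
    with that show ?thesis using pair_tuples_permute zero by (simp add: numeral_2_eq_2)
  next
    case False
    with that show ?thesis
      using step2_fixed[OF G steps(2), of n _ p] by (auto simp: partitions_of_def)
  qed
  moreover have "\<exists>c. \<forall>x y. length x = m + 1 \<and> length y = n + 1 \<and> x @ y \<in> C \<longrightarrow>
      card {z \<in> Q. x @ [z] \<in> A \<and> z # y \<in> B} = c"
    if mn: "m + n \<le> t" and cells: "A \<in> partitions_of G m" "B \<in> partitions_of G n" "C \<in> partitions_of G (m + n)"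
    for m n A B C
  proof (cases "m + n = 0")
    case True
    with cells show ?thesis using pair_tuples_regular[of A B C] zero by simp
  next
    case False
    obtain A' B' C' where *: "A' \<in> set (G ! m)" "B' \<in> set (G ! n)" "C' \<in> set (G ! (m + n))"
      "A = set A'" "B = set B'" "C = set C'"
      using cells by (auto simp: partitions_of_def)
    then obtain c where c: "\<forall>w\<in>C. inner_entry Q (m + 1) A B w = c"
      using step3_fixed[OF G steps(3), of "m + n" m A' B' C'] mn False by auto
    have "card {z \<in> Q. x @ [z] \<in> A \<and> z # y \<in> B} = c"
      if "length x = m + 1" "length y = n + 1" "x @ y \<in> C" for x y
      using bspec[OF c that(3)] that(1) by (simp add: inner_entry_def)
    then show ?thesis by blast
  qed
  ultimately show ?thesis
    unfolding extends_def prescheme_def by (simp add: zero)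
qed

text \<open>If the numbers of cells agree, the three steps compose to the identity, and by
  antisymmetry of growth each of them is the identity.\<close>

lemma pass_spec:
  assumes G: "invariant G"
  shows "time (pass d t G) \<le> N ^ 28 \<and>
    (case result (pass d t G) of None \<Rightarrow> \<forall>H. \<not> extends H
     | Some (G', refined) \<Rightarrow> invariant G' \<and>
         (if refined then cell_count G < cell_count G' else G' = G \<and> extends (partitions_of G)))"
proof (cases "result (step1 t G)")
  case None
  then have "time (pass d t G) \<le> N ^ 19"
    using step1_spec[OF G] by (simp add: pass_def)
  then have "time (pass d t G) \<le> N ^ 28" by (rule power_up) simp
  with None show ?thesis
    using step1_spec[OF G] by (simp add: pass_def)
next
  case (Some G1)
  define G2 where "G2 = result (step2 t G1)"
  define G3 where "G3 = result (step3 d t G2)"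
  have 1: "invariant G1" "grows G G1"
    using step1_spec[OF G] Some by simp_all
  have 2: "invariant G2" "grows G1 G2" "time (step2 t G1) \<le> N ^ 20"
    using refiningD[OF refining_step2 1(1)] by (simp_all add: G2_def)
  have 3: "invariant G3" "grows G2 G3" "time (step3 d t G2) \<le> N ^ 26"
    using refiningD[OF refining_step3 2(1)] by (simp_all add: G3_def)
  let ?same = "list_all2 (\<lambda>P P'. length P = length P') G G3"
  have res: "result (pass d t G) = Some (G3, \<not> ?same)"
    using Some by (simp add: pass_def G2_def G3_def same_length_t_def)
  have grows: "grows G G3"
    using 1 2 3 by (blast intro: grows_trans)
  have "time (same_length_t P P') \<le> N ^ 2" if "P \<in> set G" for P P' :: cells
  proof -
    have "length P \<le> N"
      using that level_length[OF G] length_state[OF G] by (auto simp: in_set_conv_nth less_Suc_eq_le)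
    then show ?thesis
      unfolding same_length_t_def by (intro all2_cost[where j = 0, unfolded add_0]) simp_all
  qed
  then have "time (all2_t same_length_t G G3) \<le> N ^ 4"
    using length_state[OF G] t_le d_add_6_le_N by (intro all2_cost[where j = 2, simplified]) simp_all
  then have "time (all2_t same_length_t G G3) \<le> N ^ 27" by (rule power_up) simp
  moreover have "time (step1 t G) \<le> N ^ 27" "time (step2 t G1) \<le> N ^ 27" "time (step3 d t G2) \<le> N ^ 27"
    using step1_spec[OF G] power_up[of "time (step1 t G)" 19 27] power_up[OF 2(3), of 27]
      power_up[OF 3(3), of 27] by simp_all
  ultimately have time: "time (pass d t G) \<le> N ^ 28"
    using Some nine_power[of 27] by (simp add: pass_def G2_def G3_def)
  show ?thesis
  proof (cases ?same)
    case True
    have "G3 = G" by (rule grows_same_lengths[OF grows True])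
    moreover from this have "G1 = G" "G2 = G"
      using 1(2) 2(2) 3(2) by (blast intro: grows_trans grows_antisym)+
    ultimately have "extends (partitions_of G)"
      using Some G2_def G3_def by (intro fixed_point_extends[OF G]) simp_all
    with time res True 3(1) \<open>G3 = G\<close> show ?thesis by simp
  next
    case False
    then have "G3 \<noteq> G" by (auto simp: list_all2_refl)
    with grows have "cell_count G < cell_count G3" by (simp add: grows_def)
    with time res False 3(1) show ?thesis by simp
  qed
qed

definition correct_outcome :: "outcome \<Rightarrow> bool" where
  "correct_outcome out \<longleftrightarrow> (extensible Q \<Gamma> t \<longrightarrow> outputs_extension d t \<Gamma> out) \<and>
     (\<not> extensible Q \<Gamma> t \<longrightarrow> out = Not_Extensible)"

lemma correct_outcome_Not_Extensible: "\<forall>H. \<not> extends H \<Longrightarrow> correct_outcome Not_Extensible"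
  unfolding correct_outcome_def extensible_iff by blast

lemma correct_outcome_Extension:
  assumes G: "invariant G" and ext: "extends (partitions_of G)"
  shows "correct_outcome (Extension (tl G))"
proof -
  have "encodes (tl G ! (s - 1)) (partitions_of G s)" if "1 \<le> s" "s \<le> t" for s
    using list_partition_encodes[OF level_partition[OF G that(2)]] that length_state[OF G]
    by (simp add: nth_tl partitions_of_def)
  moreover have "(partitions_of G)(0 := pair_tuples \<Gamma>) = partitions_of G"
    using ext by (simp add: extends_def fun_eq_iff)
  ultimately have "outputs_extension d t \<Gamma> (Extension (tl G))"
    using ext length_state[OF G] unfolding outputs_extension_def t_extension_def
    by (intro exI[of _ "tl G"] exI[of _ "partitions_of G"]) (simp add: extends_def)
  with ext show ?thesis
    unfolding correct_outcome_def extensible_iff by blast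
qed

text \<open>Each further pass has found at least one more cell, and there is room for at most
  \<open>N ^ 2\<close> of them.\<close>

lemma iterate_spec:
  assumes "invariant G"
  shows "\<exists>out n. iterate d t G = Some (Timed out n) \<and> correct_outcome out \<and>
    n \<le> (N ^ 2 + 1 - cell_count G) * (N ^ 28 + 1)"
  using assms
proof (induction "N ^ 2 - cell_count G" arbitrary: G rule: less_induct)
  case less
  note G = less.prems
  obtain r n where pass: "pass d t G = Timed r n" by (cases "pass d t G")
  have n: "n + 1 \<le> N ^ 28 + 1" using pass_spec[OF G] pass by simp
  have count: "cell_count G \<le> N ^ 2" by (rule cell_count_le[OF G])
  then have "1 * (N ^ 28 + 1) \<le> (N ^ 2 + 1 - cell_count G) * (N ^ 28 + 1)"
    by (intro mult_le_mono1) simp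
  with n have last: "n + 1 \<le> (N ^ 2 + 1 - cell_count G) * (N ^ 28 + 1)"
    unfolding mult_1 by (rule le_trans)
  show ?case
  proof (cases r)
    case None
    then have "\<forall>H. \<not> extends H" using pass_spec[OF G] pass by simp
    then show ?thesis
      using pass None last correct_outcome_Not_Extensible
      by (subst iterate.simps) simp
  next
    case (Some p)
    obtain G' refined where p: "p = (G', refined)" by (cases p)
    show ?thesis
    proof (cases refined)
      case False
      then have "G' = G" "extends (partitions_of G)"
        using pass_spec[OF G] pass Some p by simp_all
      then show ?thesis
        using pass Some p False last correct_outcome_Extension[OF G]
        by (subst iterate.simps) simp
    next
      case True
      then have G': "invariant G'" "cell_count G < cell_count G'"
        using pass_spec[OF G] pass Some p by simp_all
      then have count': "cell_count G' \<le> N ^ 2" using cell_count_le by blast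
      then have "N ^ 2 - cell_count G' < N ^ 2 - cell_count G"
        using G'(2) by simp
      from less.hyps[OF this G'(1)] obtain out n' where rest:
        "iterate d t G' = Some (Timed out n')" "correct_outcome out"
        "n' \<le> (N ^ 2 + 1 - cell_count G') * (N ^ 28 + 1)"
        by blast
      have "(N ^ 2 + 1 - cell_count G') + 1 \<le> N ^ 2 + 1 - cell_count G"
        using G'(2) count' by simp
      then have "(N ^ 2 + 1 - cell_count G' + 1) * (N ^ 28 + 1) \<le>
          (N ^ 2 + 1 - cell_count G) * (N ^ 28 + 1)"
        by (rule mult_le_mono1)
      moreover have "n' + (n + 1) \<le> (N ^ 2 + 1 - cell_count G' + 1) * (N ^ 28 + 1)"
        unfolding distrib_right[of _ 1] mult_1 by (rule add_mono[OF rest(3) n])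
      ultimately have "n' + (n + 1) \<le> (N ^ 2 + 1 - cell_count G) * (N ^ 28 + 1)"
        by (rule le_trans[rotated])
      then have "n + 1 + n' \<le> (N ^ 2 + 1 - cell_count G) * (N ^ 28 + 1)"
        by (simp only: add.commute)
      then show ?thesis
        using pass Some p True rest by (subst iterate.simps) simp
    qed
  qed
qed

lemma result_initial_state:
  "result (initial_state d t P0) = P0 # map (\<lambda>s. [result (tuples_t [1..<1 + d] (s + 2))]) [1..<1 + t]"
  unfolding initial_state_def result_bind result_count_from result_map_t result_return ..

lemma invariant_initial_state: "invariant (result (initial_state d t P0))"
proof -
  let ?us = "\<lambda>s. result (tuples_t [1..<1 + d] (s + 2))"
  let ?G = "P0 # map (\<lambda>s. [?us s]) [1..<1 + t]"
  have level: "?G ! s = [?us s]" if "1 \<le> s" "s \<le> t" for s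
  proof -
    have "[1..<1 + t] ! (s - 1) = s" using that by (subst nth_upt) auto
    then show ?thesis
      using that by (simp add: nth_Cons' del: upt_Suc tuples_t.simps)
  qed
  have "list_partition (tuples Q (s + 2)) (?G ! s) \<and> (\<forall>C\<in>set (?G ! s). forced s (set C))"
    if s: "s \<le> t" for s
  proof (cases "s = 0")
    case True
    then show ?thesis using P0_partition forced_P0 by (simp add: numeral_2_eq_2)
  next
    case False
    have "forced s (tuples Q (s + 2))"
      using partition_onD1[OF extends_partition[OF _ s]] by (intro forcedI) blast
    moreover have "replicate (s + 2) 1 \<in> tuples Q (s + 2)"
      using d_ge_3 by (auto simp: tuples_def)
    then have "?us s \<noteq> []"
      using set_tuples_list[of "s + 2"] by (metis empty_iff empty_set)
    moreover have "distinct (?us s)"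
      by (rule distinct_result_tuples_t) simp
    moreover have "set (?us s) = tuples Q (s + 2)"
      by (rule set_tuples_list)
    moreover have "?G ! s = [?us s]"
      by (rule level) (use False s in auto)
    ultimately show ?thesis
      by (auto simp: list_partition_def simp del: upt_Suc tuples_t.simps nth_Cons)
  qed
  then show ?thesis
    unfolding result_initial_state invariant_def by simp
qed

lemma initial_state_cost: "time (initial_state d t P0) \<le> N ^ 11"
proof -
  have tuples: "time (tuples_t [1..<1 + d] (s + 2)) \<le> N ^ 7" if "s \<le> t" for s
    using power_d_le_N[of "s + 2"] that d_add_6_le_N t_le by (intro tuples_cost) simp_all
  have "time (map_t (\<lambda>s. bind_timed (tuples_t [1..<1 + d] (s + 2)) (\<lambda>us. return [us])) [1..<1 + t])
      \<le> N ^ (7 + 2)"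
    using tuples t_le d_add_6_le_N
    by (intro map_cost) (simp_all del: upt_Suc tuples_t.simps)
  moreover have "time (count_from t 1) \<le> N ^ 9" "time (count_from d 1) \<le> N ^ 9"
    using power_up[OF count_cost, of t 9 1] power_up[OF count_cost, of d 9 1] t_le d_add_6_le_N
    by simp_all
  ultimately have "time (initial_state d t P0) \<le> 9 * N ^ 9"
    unfolding initial_state_def time_bind result_bind result_count_from by simp
  also have "\<dots> \<le> N ^ 10" using nine_power[of 9] by simp
  finally show ?thesis by (rule power_up) simp
qed

lemma extension_algorithm_spec:
  "\<exists>out n. extension_algorithm d t P0 = Some (Timed out n) \<and> n \<le> N ^ 33 \<and> correct_outcome out"
proof -
  let ?G = "result (initial_state d t P0)"
  obtain out n where it: "iterate d t ?G = Some (Timed out n)" "correct_outcome out"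
    "n \<le> (N ^ 2 + 1 - cell_count ?G) * (N ^ 28 + 1)"
    using iterate_spec[OF invariant_initial_state] by blast
  have "(N ^ 2 + 1 - cell_count ?G) * (N ^ 28 + 1) \<le> N ^ 3 * N ^ 29"
    using nine_power[of 2] nine_power[of 28] one_le_power_N[of 2] one_le_power_N[of 28]
    by (intro mult_le_mono) simp_all
  also have "N ^ 3 * N ^ 29 = N ^ 32" by (simp flip: power_add)
  finally have "n \<le> N ^ 32" using it(3) by linarith
  moreover have "time (initial_state d t P0) \<le> N ^ 32"
    by (rule power_up[OF initial_state_cost]) simp
  ultimately have "time (initial_state d t P0) + n \<le> N ^ 33"
    using nine_power[of 32] by simp
  then show ?thesis
    using it(1,2) by (simp add: extension_algorithm_def)
qed

end

theorem theorem4p2: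
  shows "\<exists>c::real. c > 0 \<and>
    (\<forall>(d::nat) (t::nat) (\<Gamma> :: (nat \<times> nat) set set) (P0 :: nat list list list).
       association_scheme {1..d} \<Gamma> \<longrightarrow> encodes P0 (pair_tuples \<Gamma>) \<longrightarrow> 1 \<le> t \<longrightarrow> t + 2 \<le> d \<longrightarrow>
       (\<exists>out n. extension_algorithm d t P0 = Some (Timed out n) \<and>
          real n \<le> real d powr (c * real t) \<and>
          (extensible {1..d} \<Gamma> t \<longrightarrow> outputs_extension d t \<Gamma> out) \<and>
          (\<not> extensible {1..d} \<Gamma> t \<longrightarrow> out = Not_Extensible)))"
  \<comment> \<open>\<open>N ^ 33 = d ^ (33 * (t + 2))\<close>, and \<open>33 * (t + 2) \<le> 99 * t\<close> because \<open>1 \<le> t\<close>.\<close>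
proof (intro exI[of _ "99 :: real"] conjI allI impI)
  fix d t :: nat and \<Gamma> :: "(nat \<times> nat) set set" and P0 :: "nat list list list"
  assume prems: "association_scheme {1..d} \<Gamma>" "encodes P0 (pair_tuples \<Gamma>)" "1 \<le> t" "t + 2 \<le> d"
  then interpret extension_problem d t \<Gamma> P0 by unfold_locales
  obtain out n where alg: "extension_algorithm d t P0 = Some (Timed out n)" "n \<le> N ^ 33"
    "correct_outcome out"
    using extension_algorithm_spec by blast
  have "n \<le> d ^ (99 * t)"
  proof -
    have "N ^ 33 = d ^ ((t + 2) * 33)" by (simp only: N_def power_mult)
    also have "\<dots> \<le> d ^ (99 * t)"
      using d_ge_3 prems(3) by (intro power_increasing) auto
    finally show ?thesis using alg(2) by linarith
  qed
  then have "real n \<le> real (d ^ (99 * t))" by (simp only: of_nat_le_iff)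
  also have "\<dots> = real d powr real (99 * t)"
    using powr_realpow[of "real d" "99 * t"] d_ge_3 by simp
  finally have "real n \<le> real d powr (99 * real t)" by simp
  with alg(1,3) show "\<exists>out n. extension_algorithm d t P0 = Some (Timed out n) \<and>
      real n \<le> real d powr (99 * real t) \<and>
      (extensible {1..d} \<Gamma> t \<longrightarrow> outputs_extension d t \<Gamma> out) \<and>
      (\<not> extensible {1..d} \<Gamma> t \<longrightarrow> out = Not_Extensible)"
    unfolding correct_outcome_def by blast
qed simp

end
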